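(* Let $C_0$ be a Cartesian category with a strong monad $(M,\mu,\eta,t)$ such that every $\eta_X$ is a monomorphism, let $K$ be the Kleisli category of $M$, $J:C_0\to K$ the canonical functor and $C=J(C_0)$, and let $\lhd$ be a consistency relation on $C\subseteq K$. Then $(C\subseteq K,\lhd)$ with the left and right Kleisli products is a weak Cartesian effect category if and only if for all objects $Y_1,Y_2$ (with projections $q_1:Y_1\times Y_2\to Y_1$ and $q'_1:Y_1\times MY_2\to Y_1$) $$ q_1\circ\,]t_{Y_1,Y_2}[\;\lhd\; q'_1 \text{ in } K,\qquad\text{or equivalently}\qquad Mq_1\circ t_{Y_1,Y_2}\;\lhd_0\;\eta_{Y_1}\circ q'_1 \text{ in } C_0 .$$ If in addition, for all objects $X,Y_1,Y_2$ and all $\varphi,\varphi':X\to M(Y_1\times Y_2)$ in $C_0$ (with projections $q_i:Y_1\times Y_2\to Y_i$), $$ \big(Mq_1\circ\varphi\;\lhd\rhd_0\;Mq_1\circ\varphi'\big)\wedge\big(Mq_2\circ\varphi=Mq_2\circ\varphi'\big)\implies\varphi=\varphi',$$ then $(C\subseteq K,\lhd)$ with the left and right Kleisli products is a Cartesian effect category.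
   Context: **Kleisli category.** A Cartesian category is a category with chosen finite products (terminal object $1$, binary products $\times$). The Kleisli category $K$ of $M$ has the objects of $C_0$, and $K(X,Y)$ is in bijection with $C_0(X,MY)$: for $f:X\to Y$ in $K$ the corresponding morphism of $C_0$ is written $[f]:X\to MY$, and for $\varphi:X\to MY$ in $C_0$ the corresponding morphism of $K$ is written $]\varphi[:X\to Y$. Identities are $[\mathrm{id}_X]=\eta_X$ and composition is $[g\circ f]=\mu_Z\circ M[g]\circ[f]$ for $f:X\to Y$, $g:Y\to Z$. The functor $J:C_0\to K$ is the identity on objects with $[J(v_0)]=\eta_Y\circ v_0$ for $v_0:X\to Y$; since every $\eta_X$ is mono, $J$ is faithful and gives an isomorphism $C_0\cong C=J(C_0)$. Morphisms of $C$ are called pure, and each pure $v$ is $J(v_0)$ for a unique $v_0$. Via this isomorphism $C$ is Cartesian; projections of $C_0$ and the corresponding pure projections in $K$ are given the same names. **Strength.** A strong monad is a monad with a strength: a natural transformation $t_{Y_1,Y_2}:Y_1\times MY_2\to M(Y_1\times Y_2)$ satisfying Moggi's four (standard) axioms: compatibility with the left unit isomorphism $r_X:1\times X\to X$ ($Mr_X\circ t_{1,X}=r_{MX}$), with associativity of $\times$, with $\eta$, and with $\mu$. **Kleisli products.** For pure $v=J(v_0):X_1\to Y_1$ and $f:X_2\to Y_2$ in $K$, the left Kleisli product $v\ltimes_{\mathrm{Kl}}f:X_1\times X_2\to Y_1\times Y_2$ in $K$ is given by $[v\ltimes_{\mathrm{Kl}}f]=t_{Y_1,Y_2}\circ(v_0\times[f])$.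 The right Kleisli product $f\rtimes_{\mathrm{Kl}}v$ ($f:X_1\to Y_1$ in $K$, $v=J(v_0):X_2\to Y_2$ pure) is defined symmetrically: $[f\rtimes_{\mathrm{Kl}}v]=t'_{Y_1,Y_2}\circ([f]\times v_0)$, where $t'_{Y_1,Y_2}:MY_1\times Y_2\to M(Y_1\times Y_2)$ is obtained from $t_{Y_2,Y_1}$ by conjugating with the swap isomorphisms of $\times$. **Consistency relations.** Here $C$ is a wide subcategory of $K$ (same objects). A consistency relation $\lhd$ on $C\subseteq K$ is a relation between parallel morphisms of $K$, the second one being pure, such that (i) $v\lhd v$ for every pure $v$; (ii) for all $f:X\to Y$, $g:Y\to Z$ in $K$ and pure $u:Y\to Y'$, $v:X\to Y'$, $w:Y'\to Z$, if $u\circ f\lhd v$ and $g\lhd w\circ u$ then $g\circ f\lhd w\circ v$. Write $f\lhd\rhd f'$ iff there is a pure $v$ with $f\lhd v$ and $f'\lhd v$. **Relations in $C_0$.** For $\varphi,\varphi':X\to MY$ in $C_0$: $\varphi\lhd_0\varphi'$ iff there is $v_0:X\to Y$ in $C_0$ with $\varphi'=\eta_Y\circ v_0$ and $]\varphi[\;\lhd J(v_0)$. And $\varphi\lhd\rhd_0\varphi'$ iff $]\varphi[\;\lhd\rhd\;]\varphi'[$, i.e. iff there is $\psi$ with $\varphi\lhd_0\psi$ and $\varphi'\lhd_0\psi$. **Effect categories.** An object $1$ terminal in $C$ is called pure terminal, and $\langle\,\rangle_X:X\to 1$ denotes the unique pure morphism. For $f:X\to Y$, $f':X\to Y'$ in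 $K$, $f\approx f'$ iff $\langle\,\rangle_Y\circ f=\langle\,\rangle_{Y'}\circ f'$. An effect category $(C\subseteq K,\lhd)$ is a category $K$ with a wide subcategory $C$, a pure terminal object and a consistency relation $\lhd$ satisfying complementarity: for parallel $f,f'$, $f\approx f'$ and $f\lhd\rhd f'$ imply $f=f'$. **(Weak) Cartesian effect categories.** Graph homomorphisms $\ltimes:C\times K\to K$ and $\rtimes:K\times C\to K$ considered here send $(X_1,X_2)$ to $X_1\times X_2$ on objects. Write $p_i:X_1\times X_2\to X_i$, $q_i:Y_1\times Y_2\to Y_i$ for the projections. A weak Cartesian effect category is an effect category $(C\subseteq K,\lhd)$ with $C$ Cartesian, together with such $\ltimes$ and $\rtimes$ satisfying the following, where the morphisms with these properties need not be unique: for all pure $v_1:X_1\to Y_1$ and $f_2:X_2\to Y_2$ in $K$, $q_1\circ(v_1\ltimes f_2)\lhd v_1\circ p_1$ and $q_2\circ(v_1\ltimes f_2)=f_2\circ p_2$; and for all $f_1:X_1\to Y_1$ in $K$ and pure $v_2:X_2\to Y_2$, $q_1\circ(f_1\rtimes v_2)=f_1\circ p_1$ and $q_2\circ(f_1\rtimes v_2)\lhd v_2\circ p_2$. It is a Cartesian effect category if in addition $\ltimes$ and $\rtimes$ extend $\times$ on pairs of pure morphisms, and $v_1\ltimes f_2$ and $f_1\rtimes v_2$ are the unique morphisms of $K$ with the respective properties.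
   Formalization: The "if and only if" adds complementarity to its right-hand side: a consistency relation need not satisfy it (on Set with the identity monad, relate all parallel maps), though every effect category must. The Cartesian part does not assume it. *)

theory Defs
  imports Main
begin

record ('o, 'm) category =
  Obj :: "'o set"
  Arr :: "'m set"
  Dom :: "'m \<Rightarrow> 'o"
  Cod :: "'m \<Rightarrow> 'o"
  Ide :: "'o \<Rightarrow> 'm"
  Comp :: "'m \<Rightarrow> 'm \<Rightarrow> 'm"  (infixr "\<cdot>\<index>" 70)

definition hom :: "('o, 'm) category \<Rightarrow> 'o \<Rightarrow> 'o \<Rightarrow> 'm set" where
  "hom C X Y = {f \<in> Arr C. Dom C f = X \<and> Cod C f = Y}"

definition parallel :: "('o, 'm) category \<Rightarrow> 'm \<Rightarrow> 'm \<Rightarrow> bool" where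
  "parallel C f g \<longleftrightarrow> f \<in> Arr C \<and> g \<in> Arr C \<and> Dom C f = Dom C g \<and> Cod C f = Cod C g"

locale category =
  fixes C :: "('o, 'm) category" (structure)
  assumes Dom_Obj: "f \<in> Arr C \<Longrightarrow> Dom C f \<in> Obj C"
    and Cod_Obj: "f \<in> Arr C \<Longrightarrow> Cod C f \<in> Obj C"
    and Ide_hom: "X \<in> Obj C \<Longrightarrow> Ide C X \<in> hom C X X"
    and Comp_hom: "f \<in> hom C X Y \<Longrightarrow> g \<in> hom C Y Z \<Longrightarrow> g \<cdot> f \<in> hom C X Z"
    and Comp_Ide: "f \<in> hom C X Y \<Longrightarrow> f \<cdot> Ide C X = f"
    and Ide_Comp: "f \<in> hom C X Y \<Longrightarrow> Ide C Y \<cdot> f = f"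
    and Comp_assoc: "f \<in> hom C W X \<Longrightarrow> g \<in> hom C X Y \<Longrightarrow> h \<in> hom C Y Z \<Longrightarrow>
      (h \<cdot> g) \<cdot> f = h \<cdot> (g \<cdot> f)"

definition mono_arrow :: "('o, 'm) category \<Rightarrow> 'm \<Rightarrow> bool" where
  "mono_arrow C m \<longleftrightarrow> m \<in> Arr C \<and>
    (\<forall>X. \<forall>f \<in> hom C X (Dom C m). \<forall>g \<in> hom C X (Dom C m).
      m \<cdot>\<^bsub>C\<^esub> f = m \<cdot>\<^bsub>C\<^esub> g \<longrightarrow> f = g)"

definition terminal :: "('o, 'm) category \<Rightarrow> 'o \<Rightarrow> bool" where
  "terminal C T \<longleftrightarrow> T \<in> Obj C \<and> (\<forall>X \<in> Obj C. \<exists>!f. f \<in> hom C X T)"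

definition bang :: "('o, 'm) category \<Rightarrow> 'o \<Rightarrow> 'o \<Rightarrow> 'm" where
  "bang C T X = (THE f. f \<in> hom C X T)"

record ('o, 'm) products =
  One :: 'o
  Prd :: "'o \<Rightarrow> 'o \<Rightarrow> 'o"
  Pr1 :: "'o \<Rightarrow> 'o \<Rightarrow> 'm"
  Pr2 :: "'o \<Rightarrow> 'o \<Rightarrow> 'm"

locale cartesian_category = category C
  for C :: "('o, 'm) category" (structure) +
  fixes S :: "('o, 'm) products"
  assumes One_terminal: "terminal C (One S)"
    and Prd_Obj: "X \<in> Obj C \<Longrightarrow> Y \<in> Obj C \<Longrightarrow> Prd S X Y \<in> Obj C"
    and Pr1_hom: "X \<in> Obj C \<Longrightarrow> Y \<in> Obj C \<Longrightarrow> Pr1 S X Y \<in> hom C (Prd S X Y) X"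
    and Pr2_hom: "X \<in> Obj C \<Longrightarrow> Y \<in> Obj C \<Longrightarrow> Pr2 S X Y \<in> hom C (Prd S X Y) Y"
    and Prd_universal: "X \<in> Obj C \<Longrightarrow> Y \<in> Obj C \<Longrightarrow> f \<in> hom C Z X \<Longrightarrow> g \<in> hom C Z Y \<Longrightarrow>
      \<exists>!h. h \<in> hom C Z (Prd S X Y) \<and> Pr1 S X Y \<cdot> h = f \<and> Pr2 S X Y \<cdot> h = g"

definition pairing :: "('o, 'm) category \<Rightarrow> ('o, 'm) products \<Rightarrow> 'm \<Rightarrow> 'm \<Rightarrow> 'm" where
  "pairing C S f g = (THE h. h \<in> hom C (Dom C f) (Prd S (Cod C f) (Cod C g)) \<and>
    Pr1 S (Cod C f) (Cod C g) \<cdot>\<^bsub>C\<^esub> h = f \<and> Pr2 S (Cod C f) (Cod C g) \<cdot>\<^bsub>C\<^esub> h = g)"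

definition times :: "('o, 'm) category \<Rightarrow> ('o, 'm) products \<Rightarrow> 'm \<Rightarrow> 'm \<Rightarrow> 'm" where
  "times C S f g = pairing C S
    (f \<cdot>\<^bsub>C\<^esub> Pr1 S (Dom C f) (Dom C g)) (g \<cdot>\<^bsub>C\<^esub> Pr2 S (Dom C f) (Dom C g))"

definition swap :: "('o, 'm) category \<Rightarrow> ('o, 'm) products \<Rightarrow> 'o \<Rightarrow> 'o \<Rightarrow> 'm" where
  "swap C S X Y = pairing C S (Pr2 S X Y) (Pr1 S X Y)"

text \<open>The associativity isomorphism from \<open>(X \<times> Y) \<times> Z\<close> to \<open>X \<times> (Y \<times> Z)\<close>.\<close>

definition associator ::
  "('o, 'm) category \<Rightarrow> ('o, 'm) products \<Rightarrow> 'o \<Rightarrow> 'o \<Rightarrow> 'o \<Rightarrow> 'm" where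
  "associator C S X Y Z = pairing C S
    (Pr1 S X Y \<cdot>\<^bsub>C\<^esub> Pr1 S (Prd S X Y) Z)
    (pairing C S (Pr2 S X Y \<cdot>\<^bsub>C\<^esub> Pr1 S (Prd S X Y) Z) (Pr2 S (Prd S X Y) Z))"

record ('o, 'm) monad =
  MO :: "'o \<Rightarrow> 'o"
  MA :: "'m \<Rightarrow> 'm"
  Mu :: "'o \<Rightarrow> 'm"
  Eta :: "'o \<Rightarrow> 'm"

locale monad = category C
  for C :: "('o, 'm) category" (structure) +
  fixes M :: "('o, 'm) monad"
  assumes MO_Obj: "X \<in> Obj C \<Longrightarrow> MO M X \<in> Obj C"
    and MA_hom: "f \<in> hom C X Y \<Longrightarrow> MA M f \<in> hom C (MO M X) (MO M Y)"
    and MA_Ide: "X \<in> Obj C \<Longrightarrow> MA M (Ide C X) = Ide C (MO M X)"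
    and MA_Comp: "f \<in> hom C X Y \<Longrightarrow> g \<in> hom C Y Z \<Longrightarrow> MA M (g \<cdot> f) = MA M g \<cdot> MA M f"
    and Eta_hom: "X \<in> Obj C \<Longrightarrow> Eta M X \<in> hom C X (MO M X)"
    and Eta_natural: "f \<in> hom C X Y \<Longrightarrow> MA M f \<cdot> Eta M X = Eta M Y \<cdot> f"
    and Mu_hom: "X \<in> Obj C \<Longrightarrow> Mu M X \<in> hom C (MO M (MO M X)) (MO M X)"
    and Mu_natural: "f \<in> hom C X Y \<Longrightarrow> MA M f \<cdot> Mu M X = Mu M Y \<cdot> MA M (MA M f)"
    and Mu_Eta: "X \<in> Obj C \<Longrightarrow> Mu M X \<cdot> Eta M (MO M X) = Ide C (MO M X)"
    and Mu_MA_Eta: "X \<in> Obj C \<Longrightarrow> Mu M X \<cdot> MA M (Eta M X) = Ide C (MO M X)"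
    and Mu_Mu: "X \<in> Obj C \<Longrightarrow> Mu M X \<cdot> Mu M (MO M X) = Mu M X \<cdot> MA M (Mu M X)"

text \<open>The left unit isomorphism from \<open>1 \<times> X\<close> to \<open>X\<close> is the second projection.\<close>

locale strong_monad = cartesian_category C S + monad C M
  for C :: "('o, 'm) category" (structure)
    and S :: "('o, 'm) products"
    and M :: "('o, 'm) monad" +
  fixes t :: "'o \<Rightarrow> 'o \<Rightarrow> 'm"
  assumes t_hom: "Y1 \<in> Obj C \<Longrightarrow> Y2 \<in> Obj C \<Longrightarrow>
      t Y1 Y2 \<in> hom C (Prd S Y1 (MO M Y2)) (MO M (Prd S Y1 Y2))"
    and t_natural: "f1 \<in> hom C X1 Y1 \<Longrightarrow> f2 \<in> hom C X2 Y2 \<Longrightarrow>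
      MA M (times C S f1 f2) \<cdot> t X1 X2 = t Y1 Y2 \<cdot> times C S f1 (MA M f2)"
    and t_unit: "X \<in> Obj C \<Longrightarrow>
      MA M (Pr2 S (One S) X) \<cdot> t (One S) X = Pr2 S (One S) (MO M X)"
    and t_assoc: "X \<in> Obj C \<Longrightarrow> Y \<in> Obj C \<Longrightarrow> Z \<in> Obj C \<Longrightarrow>
      MA M (associator C S X Y Z) \<cdot> t (Prd S X Y) Z =
      t X (Prd S Y Z) \<cdot> times C S (Ide C X) (t Y Z) \<cdot> associator C S X Y (MO M Z)"
    and t_Eta: "X \<in> Obj C \<Longrightarrow> Y \<in> Obj C \<Longrightarrow>
      t X Y \<cdot> times C S (Ide C X) (Eta M Y) = Eta M (Prd S X Y)"
    and t_Mu: "X \<in> Obj C \<Longrightarrow> Y \<in> Obj C \<Longrightarrow>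
      t X Y \<cdot> times C S (Ide C X) (Mu M Y) = Mu M (Prd S X Y) \<cdot> MA M (t X Y) \<cdot> t X (MO M Y)"

text \<open>
  In what follows \<open>P\<close> is the set of pure morphisms (the arrows of a wide subcategory of \<open>K\<close>)
  and \<open>R\<close> is the relation \<open>\<lhd>\<close>; \<open>consistent\<close> and \<open>same_effect\<close> are \<open>\<lhd>\<rhd>\<close> and \<open>\<approx>\<close>.
\<close>

definition wide_subcategory :: "('o, 'm) category \<Rightarrow> 'm set \<Rightarrow> bool" where
  "wide_subcategory K P \<longleftrightarrow> P \<subseteq> Arr K \<and> (\<forall>X \<in> Obj K. Ide K X \<in> P) \<and>
    (\<forall>v \<in> P. \<forall>w \<in> P. Cod K v = Dom K w \<longrightarrow> w \<cdot>\<^bsub>K\<^esub> v \<in> P)"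

definition subcat :: "('o, 'm) category \<Rightarrow> 'm set \<Rightarrow> ('o, 'm) category" where
  "subcat K P = K\<lparr>Arr := P\<rparr>"

definition consistency_relation ::
  "('o, 'm) category \<Rightarrow> 'm set \<Rightarrow> ('m \<Rightarrow> 'm \<Rightarrow> bool) \<Rightarrow> bool" where
  "consistency_relation K P R \<longleftrightarrow>
    (\<forall>f v. R f v \<longrightarrow> parallel K f v \<and> v \<in> P) \<and>
    (\<forall>v \<in> P. R v v) \<and>
    (\<forall>X Y Z Y' f g u v w.
      f \<in> hom K X Y \<longrightarrow> g \<in> hom K Y Z \<longrightarrow>
      u \<in> hom (subcat K P) Y Y' \<longrightarrow> v \<in> hom (subcat K P) X Y' \<longrightarrow> w \<in> hom (subcat K P) Y' Z \<longrightarrow>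
      R (u \<cdot>\<^bsub>K\<^esub> f) v \<longrightarrow> R g (w \<cdot>\<^bsub>K\<^esub> u) \<longrightarrow> R (g \<cdot>\<^bsub>K\<^esub> f) (w \<cdot>\<^bsub>K\<^esub> v))"

definition consistent :: "'m set \<Rightarrow> ('m \<Rightarrow> 'm \<Rightarrow> bool) \<Rightarrow> 'm \<Rightarrow> 'm \<Rightarrow> bool" where
  "consistent P R f f' \<longleftrightarrow> (\<exists>v \<in> P. R f v \<and> R f' v)"

definition same_effect :: "('o, 'm) category \<Rightarrow> 'm set \<Rightarrow> 'o \<Rightarrow> 'm \<Rightarrow> 'm \<Rightarrow> bool" where
  "same_effect K P T f f' \<longleftrightarrow>
    bang (subcat K P) T (Cod K f) \<cdot>\<^bsub>K\<^esub> f = bang (subcat K P) T (Cod K f') \<cdot>\<^bsub>K\<^esub> f'"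

definition complementarity ::
  "('o, 'm) category \<Rightarrow> 'm set \<Rightarrow> 'o \<Rightarrow> ('m \<Rightarrow> 'm \<Rightarrow> bool) \<Rightarrow> bool" where
  "complementarity K P T R \<longleftrightarrow>
    (\<forall>f f'. parallel K f f' \<longrightarrow> same_effect K P T f f' \<longrightarrow> consistent P R f f' \<longrightarrow> f = f')"

definition effect_category ::
  "('o, 'm) category \<Rightarrow> 'm set \<Rightarrow> 'o \<Rightarrow> ('m \<Rightarrow> 'm \<Rightarrow> bool) \<Rightarrow> bool" where
  "effect_category K P T R \<longleftrightarrow>
    category K \<and> wide_subcategory K P \<and> terminal (subcat K P) T \<and>
    consistency_relation K P R \<and> complementarity K P T R"

text \<open>The two conditions defining \<open>v1 \<ltimes> f2\<close> and \<open>f1 \<rtimes> v2\<close>, for a candidate \<open>h\<close>.\<close>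

definition left_property ::
  "('o, 'm) category \<Rightarrow> ('o, 'm) products \<Rightarrow> ('m \<Rightarrow> 'm \<Rightarrow> bool) \<Rightarrow> 'm \<Rightarrow> 'm \<Rightarrow> 'm \<Rightarrow> bool" where
  "left_property K S R v1 f2 h \<longleftrightarrow>
    R (Pr1 S (Cod K v1) (Cod K f2) \<cdot>\<^bsub>K\<^esub> h) (v1 \<cdot>\<^bsub>K\<^esub> Pr1 S (Dom K v1) (Dom K f2)) \<and>
    Pr2 S (Cod K v1) (Cod K f2) \<cdot>\<^bsub>K\<^esub> h = f2 \<cdot>\<^bsub>K\<^esub> Pr2 S (Dom K v1) (Dom K f2)"

definition right_property ::
  "('o, 'm) category \<Rightarrow> ('o, 'm) products \<Rightarrow> ('m \<Rightarrow> 'm \<Rightarrow> bool) \<Rightarrow> 'm \<Rightarrow> 'm \<Rightarrow> 'm \<Rightarrow> bool" where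
  "right_property K S R f1 v2 h \<longleftrightarrow>
    Pr1 S (Cod K f1) (Cod K v2) \<cdot>\<^bsub>K\<^esub> h = f1 \<cdot>\<^bsub>K\<^esub> Pr1 S (Dom K f1) (Dom K v2) \<and>
    R (Pr2 S (Cod K f1) (Cod K v2) \<cdot>\<^bsub>K\<^esub> h) (v2 \<cdot>\<^bsub>K\<^esub> Pr2 S (Dom K f1) (Dom K v2))"

definition prod_hom :: "('o, 'm) category \<Rightarrow> ('o, 'm) products \<Rightarrow> 'm \<Rightarrow> 'm \<Rightarrow> 'm set" where
  "prod_hom K S f g = hom K (Prd S (Dom K f) (Dom K g)) (Prd S (Cod K f) (Cod K g))"

definition weak_cartesian_effect_category ::
  "('o, 'm) category \<Rightarrow> 'm set \<Rightarrow> ('o, 'm) products \<Rightarrow> ('m \<Rightarrow> 'm \<Rightarrow> bool) \<Rightarrow>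
    ('m \<Rightarrow> 'm \<Rightarrow> 'm) \<Rightarrow> ('m \<Rightarrow> 'm \<Rightarrow> 'm) \<Rightarrow> bool" where
  "weak_cartesian_effect_category K P S R lt rt \<longleftrightarrow>
    effect_category K P (One S) R \<and>
    cartesian_category (subcat K P) S \<and>
    (\<forall>v \<in> P. \<forall>f \<in> Arr K. lt v f \<in> prod_hom K S v f \<and> left_property K S R v f (lt v f)) \<and>
    (\<forall>f \<in> Arr K. \<forall>v \<in> P. rt f v \<in> prod_hom K S f v \<and> right_property K S R f v (rt f v))"

definition cartesian_effect_category ::
  "('o, 'm) category \<Rightarrow> 'm set \<Rightarrow> ('o, 'm) products \<Rightarrow> ('m \<Rightarrow> 'm \<Rightarrow> bool) \<Rightarrow>
    ('m \<Rightarrow> 'm \<Rightarrow> 'm) \<Rightarrow> ('m \<Rightarrow> 'm \<Rightarrow> 'm) \<Rightarrow> bool" where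
  "cartesian_effect_category K P S R lt rt \<longleftrightarrow>
    weak_cartesian_effect_category K P S R lt rt \<and>
    (\<forall>v \<in> P. \<forall>w \<in> P. lt v w = times (subcat K P) S v w \<and> rt v w = times (subcat K P) S v w) \<and>
    (\<forall>v \<in> P. \<forall>f \<in> Arr K. \<forall>h \<in> prod_hom K S v f. left_property K S R v f h \<longrightarrow> h = lt v f) \<and>
    (\<forall>f \<in> Arr K. \<forall>v \<in> P. \<forall>h \<in> prod_hom K S f v. right_property K S R f v h \<longrightarrow> h = rt f v)"

text \<open>
  \<open>KArr X Y \<phi>\<close> is the Kleisli morphism \<open>]\<phi>[\<close> from \<open>X\<close> to \<open>Y\<close>, and \<open>kmor f\<close> is \<open>[f]\<close>.
  The objects are stored because \<open>M\<close> need not be injective on objects, so that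
  \<open>\<phi> : X \<rightarrow> M Y\<close> does not determine \<open>Y\<close>.
\<close>

datatype ('o, 'm) karr = KArr (kdom: 'o) (kcod: 'o) (kmor: 'm)

definition kleisli ::
  "('o, 'm) category \<Rightarrow> ('o, 'm) monad \<Rightarrow> ('o, ('o, 'm) karr) category" where
  "kleisli C M = \<lparr>
    Obj = Obj C,
    Arr = {KArr X Y \<phi> | X Y \<phi>. X \<in> Obj C \<and> Y \<in> Obj C \<and> \<phi> \<in> hom C X (MO M Y)},
    Dom = kdom,
    Cod = kcod,
    Ide = (\<lambda>X. KArr X X (Eta M X)),
    Comp = (\<lambda>g f. KArr (kdom f) (kcod g)
      (Mu M (kcod g) \<cdot>\<^bsub>C\<^esub> MA M (kmor g) \<cdot>\<^bsub>C\<^esub> kmor f))\<rparr>"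

definition kleisli_J ::
  "('o, 'm) category \<Rightarrow> ('o, 'm) monad \<Rightarrow> 'm \<Rightarrow> ('o, 'm) karr" where
  "kleisli_J C M v = KArr (Dom C v) (Cod C v) (Eta M (Cod C v) \<cdot>\<^bsub>C\<^esub> v)"

definition kleisli_pure :: "('o, 'm) category \<Rightarrow> ('o, 'm) monad \<Rightarrow> ('o, 'm) karr set" where
  "kleisli_pure C M = kleisli_J C M ` Arr C"

definition kleisli_products ::
  "('o, 'm) category \<Rightarrow> ('o, 'm) products \<Rightarrow> ('o, 'm) monad \<Rightarrow> ('o, ('o, 'm) karr) products" where
  "kleisli_products C S M = \<lparr>
    One = One S,
    Prd = Prd S,
    Pr1 = (\<lambda>X Y. kleisli_J C M (Pr1 S X Y)),
    Pr2 = (\<lambda>X Y. kleisli_J C M (Pr2 S X Y))\<rparr>"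

text \<open>The morphism \<open>v\<^sub>0\<close> with \<open>J v\<^sub>0 = v\<close>; unique when the units of the monad are mono.\<close>

definition pure_part ::
  "('o, 'm) category \<Rightarrow> ('o, 'm) monad \<Rightarrow> ('o, 'm) karr \<Rightarrow> 'm" where
  "pure_part C M v = (THE v0. v0 \<in> Arr C \<and> kleisli_J C M v0 = v)"

definition costrength ::
  "('o, 'm) category \<Rightarrow> ('o, 'm) products \<Rightarrow> ('o, 'm) monad \<Rightarrow> ('o \<Rightarrow> 'o \<Rightarrow> 'm) \<Rightarrow>
    'o \<Rightarrow> 'o \<Rightarrow> 'm" where
  "costrength C S M t Y1 Y2 =
    MA M (swap C S Y2 Y1) \<cdot>\<^bsub>C\<^esub> t Y2 Y1 \<cdot>\<^bsub>C\<^esub> swap C S (MO M Y1) Y2"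

definition kleisli_left ::
  "('o, 'm) category \<Rightarrow> ('o, 'm) products \<Rightarrow> ('o, 'm) monad \<Rightarrow> ('o \<Rightarrow> 'o \<Rightarrow> 'm) \<Rightarrow>
    ('o, 'm) karr \<Rightarrow> ('o, 'm) karr \<Rightarrow> ('o, 'm) karr" where
  "kleisli_left C S M t v f = KArr (Prd S (kdom v) (kdom f)) (Prd S (kcod v) (kcod f))
    (t (kcod v) (kcod f) \<cdot>\<^bsub>C\<^esub> times C S (pure_part C M v) (kmor f))"

definition kleisli_right ::
  "('o, 'm) category \<Rightarrow> ('o, 'm) products \<Rightarrow> ('o, 'm) monad \<Rightarrow> ('o \<Rightarrow> 'o \<Rightarrow> 'm) \<Rightarrow>
    ('o, 'm) karr \<Rightarrow> ('o, 'm) karr \<Rightarrow> ('o, 'm) karr" where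
  "kleisli_right C S M t f v = KArr (Prd S (kdom f) (kdom v)) (Prd S (kcod f) (kcod v))
    (costrength C S M t (kcod f) (kcod v) \<cdot>\<^bsub>C\<^esub> times C S (kmor f) (pure_part C M v))"

text \<open>
  The relations \<open>\<lhd>\<^sub>0\<close> and \<open>\<lhd>\<rhd>\<^sub>0\<close> on morphisms \<open>\<phi>, \<phi>' : X \<rightarrow> M Y\<close> induced by a relation
  \<open>R\<close> on Kleisli morphisms.
\<close>

definition rel0 ::
  "('o, 'm) category \<Rightarrow> ('o, 'm) monad \<Rightarrow> (('o, 'm) karr \<Rightarrow> ('o, 'm) karr \<Rightarrow> bool) \<Rightarrow>
    'o \<Rightarrow> 'o \<Rightarrow> 'm \<Rightarrow> 'm \<Rightarrow> bool" where
  "rel0 C M R X Y \<phi> \<phi>' \<longleftrightarrow>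
    (\<exists>v0 \<in> hom C X Y. \<phi>' = Eta M Y \<cdot>\<^bsub>C\<^esub> v0 \<and> R (KArr X Y \<phi>) (kleisli_J C M v0))"

definition consistent0 ::
  "('o, 'm) category \<Rightarrow> ('o, 'm) monad \<Rightarrow> (('o, 'm) karr \<Rightarrow> ('o, 'm) karr \<Rightarrow> bool) \<Rightarrow>
    'o \<Rightarrow> 'o \<Rightarrow> 'm \<Rightarrow> 'm \<Rightarrow> bool" where
  "consistent0 C M R X Y \<phi> \<phi>' \<longleftrightarrow>
    consistent (kleisli_pure C M) R (KArr X Y \<phi>) (KArr X Y \<phi>')"

end

theory Submission
  imports Defs
begin

text \<open>
  Composing a Kleisli morphism with a pure one involves no multiplication: \<open>[J v \<circ> f] = M v \<circ> [f]\<close>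
  and \<open>[g \<circ> J v] = [g] \<circ> v\<close>. The identity \<open>M q\<^sub>2 \<circ> t = q\<^sub>2'\<close> holds for every strength, so the second
  half of the left property is automatic; as \<open>v \<ltimes> f = ]t[ \<circ> J (v\<^sub>0 \<times> [f])\<close> and \<open>\<lhd>\<close> is stable under
  precomposition by pure morphisms, the first half follows from \<open>q\<^sub>1 \<circ> ]t[ \<lhd> q\<^sub>1'\<close>, which is itself the
  case \<open>v = id\<close>, \<open>[f] = id\<close>. The right product is the left one conjugated by pure swaps.
  Complementarity is the joint cancellation property of the projections for \<open>Y \<times> 1 \<cong> Y\<close>, where
  equality of second projections is equality of effects.
\<close>

subsection \<open>Categories and finite products\<close>

lemma hom_iff: "f \<in> hom C X Y \<longleftrightarrow> f \<in> Arr C \<and> Dom C f = X \<and> Cod C f = Y"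
  by (auto simp: hom_def)

context category
begin

declare Dom_Obj [simp] Cod_Obj [simp]

lemma Ide_simps [simp]:
  assumes "X \<in> Obj C"
  shows "Ide C X \<in> Arr C" "Dom C (Ide C X) = X" "Cod C (Ide C X) = X"
  using Ide_hom[OF assms] by (auto simp: hom_iff)

lemma Comp_simps [simp]:
  assumes "f \<in> Arr C" "g \<in> Arr C" "Cod C f = Dom C g"
  shows "g \<cdot> f \<in> Arr C" "Dom C (g \<cdot> f) = Dom C f" "Cod C (g \<cdot> f) = Cod C g"
  using Comp_hom[of f "Dom C f" "Dom C g" g "Cod C g"] assms by (auto simp: hom_iff)

lemma Comp_Ide_simps [simp]:
  assumes "f \<in> Arr C"
  shows "Dom C f = X \<Longrightarrow> f \<cdot> Ide C X = f" "Cod C f = Y \<Longrightarrow> Ide C Y \<cdot> f = f"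
  using Comp_Ide[of f "Dom C f" "Cod C f"] Ide_Comp[of f "Dom C f" "Cod C f"] assms
  by (auto simp: hom_iff)

lemma Comp_assoc_simp [simp]:
  assumes "f \<in> Arr C" "g \<in> Arr C" "h \<in> Arr C" "Cod C f = Dom C g" "Cod C g = Dom C h"
  shows "(h \<cdot> g) \<cdot> f = h \<cdot> g \<cdot> f"
  using Comp_assoc[of f "Dom C f" "Dom C g" g "Dom C h" h "Cod C h"] assms
  by (auto simp: hom_iff)

lemma category_subcat:
  assumes "wide_subcategory C P"
  shows "category (subcat C P)"
  using assms Comp_assoc_simp
  by unfold_locales (auto simp: subcat_def wide_subcategory_def hom_iff subset_iff)

text \<open>The second axiom of a consistency relation, with the pure \<open>v\<close> as first
  factor and an identity as the auxiliary morphism; its first premise is then reflexivity of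
  \<open>R\<close> at \<open>v\<close>.\<close>

lemma consistency_relation_precomp:
  assumes wide: "wide_subcategory C P" and cons: "consistency_relation C P R"
    and R: "R g w" and v: "v \<in> P" and eq: "Cod C v = Dom C g"
  shows "R (g \<cdot> v) (w \<cdot> v)"
proof -
  have w: "w \<in> P" and par: "parallel C g w"
    using cons R by (auto simp: consistency_relation_def)
  then have arr: "g \<in> Arr C" "w \<in> Arr C" "Dom C g = Dom C w" "Cod C g = Cod C w"
    by (auto simp: parallel_def)
  have vA: "v \<in> Arr C" using wide v by (auto simp: wide_subcategory_def)
  have I: "Ide C (Dom C g) \<in> P"
    using wide arr by (auto simp: wide_subcategory_def)
  have "R v v" using cons v by (auto simp: consistency_relation_def)
  then have 1: "R (Ide C (Dom C g) \<cdot> v) v" using vA eq arr by simp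
  have 2: "R g (w \<cdot> Ide C (Dom C g))" using R arr by simp
  have step: "f \<in> hom C X Y \<Longrightarrow> g \<in> hom C Y Z \<Longrightarrow>
      u \<in> hom (subcat C P) Y Y' \<Longrightarrow> v \<in> hom (subcat C P) X Y' \<Longrightarrow> w \<in> hom (subcat C P) Y' Z \<Longrightarrow>
      R (u \<cdot> f) v \<Longrightarrow> R g (w \<cdot> u) \<Longrightarrow> R (g \<cdot> f) (w \<cdot> v)" for f g u v w X Y Z Y'
    using cons unfolding consistency_relation_def by blast
  show ?thesis
    by (rule step[OF _ _ _ _ _ 1 2, of "Dom C v" "Dom C g" "Cod C g" "Dom C g"])
      (use vA v w arr eq I in \<open>auto simp: hom_iff subcat_def\<close>)
qed

end

context cartesian_category
begin

lemma One_Obj [simp]: "One S \<in> Obj C"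
  using One_terminal by (simp add: terminal_def)

lemma bang_hom: "X \<in> Obj C \<Longrightarrow> bang C (One S) X \<in> hom C X (One S)"
  unfolding bang_def by (rule theI') (use One_terminal in \<open>simp add: terminal_def\<close>)

lemma bang_simps [simp]:
  assumes "X \<in> Obj C"
  shows "bang C (One S) X \<in> Arr C" "Dom C (bang C (One S) X) = X"
    "Cod C (bang C (One S) X) = One S"
  using bang_hom[OF assms] by (auto simp: hom_iff)

lemma bang_unique:
  "\<lbrakk>f \<in> Arr C; Cod C f = One S; Dom C f = X\<rbrakk> \<Longrightarrow> bang C (One S) X = f"
  using One_terminal bang_hom[of X] Dom_Obj[of f] unfolding terminal_def
  by (metis hom_iff)

declare Prd_Obj [simp]

lemma Pr_simps [simp]:
  assumes "X \<in> Obj C" "Y \<in> Obj C"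
  shows "Pr1 S X Y \<in> Arr C" "Dom C (Pr1 S X Y) = Prd S X Y" "Cod C (Pr1 S X Y) = X"
    "Pr2 S X Y \<in> Arr C" "Dom C (Pr2 S X Y) = Prd S X Y" "Cod C (Pr2 S X Y) = Y"
  using Pr1_hom[OF assms] Pr2_hom[OF assms] by (auto simp: hom_iff)

lemma Prd_eqI:
  assumes "h \<in> Arr C" "k \<in> Arr C" "Cod C h = Prd S X Y" "Cod C k = Prd S X Y"
    "X \<in> Obj C" "Y \<in> Obj C" "Dom C h = Dom C k"
    "Pr1 S X Y \<cdot> h = Pr1 S X Y \<cdot> k" "Pr2 S X Y \<cdot> h = Pr2 S X Y \<cdot> k"
  shows "h = k"
proof -
  have "\<exists>!l. l \<in> hom C (Dom C h) (Prd S X Y) \<and>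
      Pr1 S X Y \<cdot> l = Pr1 S X Y \<cdot> h \<and> Pr2 S X Y \<cdot> l = Pr2 S X Y \<cdot> h"
    using assms by (intro Prd_universal) (auto simp: hom_iff)
  then show ?thesis using assms by (auto simp: hom_iff)
qed

lemma pairing_spec:
  assumes "f \<in> Arr C" "g \<in> Arr C" "Dom C f = Dom C g"
  shows "pairing C S f g \<in> hom C (Dom C f) (Prd S (Cod C f) (Cod C g)) \<and>
    Pr1 S (Cod C f) (Cod C g) \<cdot> pairing C S f g = f \<and>
    Pr2 S (Cod C f) (Cod C g) \<cdot> pairing C S f g = g"
  unfolding pairing_def
  by (rule theI', rule Prd_universal) (use assms in \<open>auto simp: hom_iff\<close>)

lemma pairing_simps [simp]:
  assumes "f \<in> Arr C" "g \<in> Arr C" "Dom C f = Dom C g"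
  shows "pairing C S f g \<in> Arr C" "Dom C (pairing C S f g) = Dom C g"
    "Cod C (pairing C S f g) = Prd S (Cod C f) (Cod C g)"
    "Cod C f = X \<Longrightarrow> Cod C g = Y \<Longrightarrow> Pr1 S X Y \<cdot> pairing C S f g = f"
    "Cod C f = X \<Longrightarrow> Cod C g = Y \<Longrightarrow> Pr2 S X Y \<cdot> pairing C S f g = g"
  using pairing_spec[OF assms] assms by (auto simp: hom_iff)

lemma times_simps [simp]:
  assumes "f \<in> Arr C" "g \<in> Arr C"
  shows "times C S f g \<in> Arr C" "Dom C (times C S f g) = Prd S (Dom C f) (Dom C g)"
    "Cod C (times C S f g) = Prd S (Cod C f) (Cod C g)"
    "Cod C f = X \<Longrightarrow> Cod C g = Y \<Longrightarrow>
      Pr1 S X Y \<cdot> times C S f g = f \<cdot> Pr1 S (Dom C f) (Dom C g)"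
    "Cod C f = X \<Longrightarrow> Cod C g = Y \<Longrightarrow>
      Pr2 S X Y \<cdot> times C S f g = g \<cdot> Pr2 S (Dom C f) (Dom C g)"
  using assms by (simp_all add: times_def)

lemma swap_simps [simp]:
  assumes "X \<in> Obj C" "Y \<in> Obj C"
  shows "swap C S X Y \<in> Arr C" "Dom C (swap C S X Y) = Prd S X Y"
    "Cod C (swap C S X Y) = Prd S Y X"
    "Pr1 S Y X \<cdot> swap C S X Y = Pr2 S X Y" "Pr2 S Y X \<cdot> swap C S X Y = Pr1 S X Y"
  using assms by (simp_all add: swap_def)

text \<open>The simplifier nests composites to the right, so the rules for a projection after
  \<open>swap\<close> or \<open>times\<close> no longer match once a further factor follows; these
  variants carry that factor \<open>h\<close>.\<close>

lemma Pr_Comp_simps [simp]: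
  assumes "X \<in> Obj C" "Y \<in> Obj C" "h \<in> Arr C"
  shows "Cod C h = Prd S X Y \<Longrightarrow> Pr1 S Y X \<cdot> swap C S X Y \<cdot> h = Pr2 S X Y \<cdot> h"
    "Cod C h = Prd S X Y \<Longrightarrow> Pr2 S Y X \<cdot> swap C S X Y \<cdot> h = Pr1 S X Y \<cdot> h"
    "\<lbrakk>f \<in> Arr C; g \<in> Arr C; Cod C f = X; Cod C g = Y; Cod C h = Prd S (Dom C f) (Dom C g)\<rbrakk> \<Longrightarrow>
      Pr1 S X Y \<cdot> times C S f g \<cdot> h = f \<cdot> Pr1 S (Dom C f) (Dom C g) \<cdot> h"
    "\<lbrakk>f \<in> Arr C; g \<in> Arr C; Cod C f = X; Cod C g = Y; Cod C h = Prd S (Dom C f) (Dom C g)\<rbrakk> \<Longrightarrow>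
      Pr2 S X Y \<cdot> times C S f g \<cdot> h = g \<cdot> Pr2 S (Dom C f) (Dom C g) \<cdot> h"
proof -
  show "Pr1 S Y X \<cdot> swap C S X Y \<cdot> h = Pr2 S X Y \<cdot> h" if "Cod C h = Prd S X Y"
    using assms that by (simp flip: Comp_assoc_simp)
  show "Pr2 S Y X \<cdot> swap C S X Y \<cdot> h = Pr1 S X Y \<cdot> h" if "Cod C h = Prd S X Y"
    using assms that by (simp flip: Comp_assoc_simp)
  show "Pr1 S X Y \<cdot> times C S f g \<cdot> h = f \<cdot> Pr1 S (Dom C f) (Dom C g) \<cdot> h"
    "Pr2 S X Y \<cdot> times C S f g \<cdot> h = g \<cdot> Pr2 S (Dom C f) (Dom C g) \<cdot> h"
    if "f \<in> Arr C" "g \<in> Arr C" "Cod C f = X" "Cod C g = Y" "Cod C h = Prd S (Dom C f) (Dom C g)"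
    using assms that by (simp_all flip: Comp_assoc_simp)
qed

lemma swap_swap:
  assumes "X \<in> Obj C" "Y \<in> Obj C"
  shows "swap C S Y X \<cdot> swap C S X Y = Ide C (Prd S X Y)"
  by (rule Prd_eqI[of _ _ X Y]) (use assms in simp_all)

lemma times_Ide_Ide:
  assumes "X \<in> Obj C" "Y \<in> Obj C"
  shows "times C S (Ide C X) (Ide C Y) = Ide C (Prd S X Y)"
  by (rule Prd_eqI[of _ _ X Y]) (use assms in simp_all)

lemma times_Comp:
  assumes "f \<in> Arr C" "g \<in> Arr C" "f' \<in> Arr C" "g' \<in> Arr C"
    "Cod C f = Dom C f'" "Cod C g = Dom C g'"
  shows "times C S f' g' \<cdot> times C S f g = times C S (f' \<cdot> f) (g' \<cdot> g)"
  by (rule Prd_eqI[of _ _ "Cod C f'" "Cod C g'"]) (use assms in simp_all)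

lemma swap_times:
  assumes "f \<in> Arr C" "g \<in> Arr C" "Cod C f = X" "Cod C g = Y"
  shows "swap C S X Y \<cdot> times C S f g = times C S g f \<cdot> swap C S (Dom C f) (Dom C g)"
  by (rule Prd_eqI[of _ _ "Cod C g" "Cod C f"]) (use assms in auto)

end

subsection \<open>Kleisli categories\<close>

context monad
begin

declare MO_Obj [simp]

lemma monad_simps [simp]:
  assumes "X \<in> Obj C"
  shows "Eta M X \<in> Arr C" "Dom C (Eta M X) = X" "Cod C (Eta M X) = MO M X"
    "Mu M X \<in> Arr C" "Dom C (Mu M X) = MO M (MO M X)" "Cod C (Mu M X) = MO M X"
    "MA M (Ide C X) = Ide C (MO M X)"
    "Mu M X \<cdot> Eta M (MO M X) = Ide C (MO M X)"
    "Mu M X \<cdot> MA M (Eta M X) = Ide C (MO M X)"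
  using Eta_hom[OF assms] Mu_hom[OF assms] MA_Ide[OF assms] Mu_Eta[OF assms]
    Mu_MA_Eta[OF assms] by (auto simp: hom_iff)

lemma MA_simps [simp]:
  assumes "f \<in> Arr C"
  shows "MA M f \<in> Arr C" "Dom C (MA M f) = MO M (Dom C f)" "Cod C (MA M f) = MO M (Cod C f)"
  using MA_hom[of f "Dom C f" "Cod C f"] assms by (auto simp: hom_iff)

lemma MA_Comp_simp [simp]:
  assumes "f \<in> Arr C" "g \<in> Arr C" "Cod C f = Dom C g"
  shows "MA M (g \<cdot> f) = MA M g \<cdot> MA M f"
  using MA_Comp[of f "Dom C f" "Dom C g" g "Cod C g"] assms by (auto simp: hom_iff)

text \<open>Runs against \<open>MA_Comp_simp\<close>: merging the two images lets a composite such
  as a projection after a swap be simplified inside \<open>MA M\<close>.\<close>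

lemma MA_Comp_Comp:
  assumes "f \<in> Arr C" "g \<in> Arr C" "h \<in> Arr C" "Cod C f = Dom C g" "Cod C h = MO M (Dom C f)"
  shows "MA M g \<cdot> MA M f \<cdot> h = MA M (g \<cdot> f) \<cdot> h"
  using assms by simp

lemma Eta_Comp:
  assumes "f \<in> Arr C" "Cod C f = Y"
  shows "Eta M Y \<cdot> f = MA M f \<cdot> Eta M (Dom C f)"
  using Eta_natural[of f "Dom C f" Y] assms by (auto simp: hom_iff)

lemma MA_Mu:
  assumes "f \<in> Arr C" "Dom C f = X"
  shows "MA M f \<cdot> Mu M X = Mu M (Cod C f) \<cdot> MA M (MA M f)"
  using Mu_natural[of f X "Cod C f"] assms by (auto simp: hom_iff)

lemma Mu_MA_Eta_Comp:
  assumes "X \<in> Obj C" "f \<in> Arr C" "Cod C f = MO M X"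
  shows "Mu M X \<cdot> MA M (Eta M X) \<cdot> f = f"
  using assms by (simp flip: Comp_assoc_simp)

lemma Mu_Eta_Comp:
  assumes "X \<in> Obj C" "f \<in> Arr C" "Cod C f = MO M X"
  shows "Mu M X \<cdot> Eta M (MO M X) \<cdot> f = f"
  using assms by (simp flip: Comp_assoc_simp)

lemma kleisli_simps [simp]:
  "Obj (kleisli C M) = Obj C" "Dom (kleisli C M) = kdom" "Cod (kleisli C M) = kcod"
  "Ide (kleisli C M) X = KArr X X (Eta M X)"
  by (auto simp: kleisli_def)

lemma kleisli_Comp:
  "g \<cdot>\<^bsub>kleisli C M\<^esub> f = KArr (kdom f) (kcod g) (Mu M (kcod g) \<cdot> MA M (kmor g) \<cdot> kmor f)"
  by (simp add: kleisli_def)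

lemma kleisli_Arr:
  "f \<in> Arr (kleisli C M) \<longleftrightarrow> kdom f \<in> Obj C \<and> kcod f \<in> Obj C \<and>
    kmor f \<in> Arr C \<and> Dom C (kmor f) = kdom f \<and> Cod C (kmor f) = MO M (kcod f)"
  by (cases f) (auto simp: kleisli_def hom_iff)

lemma kleisli_J_simps [simp]:
  "kdom (kleisli_J C M v) = Dom C v" "kcod (kleisli_J C M v) = Cod C v"
  "kmor (kleisli_J C M v) = Eta M (Cod C v) \<cdot> v"
  by (auto simp: kleisli_J_def)

lemma kleisli_J_Arr: "v \<in> Arr C \<Longrightarrow> kleisli_J C M v \<in> Arr (kleisli C M)"
  by (simp add: kleisli_Arr)

text \<open>The unit law for \<open>MA M (Eta M X)\<close> cancels the multiplication.\<close>

lemma J_kleisli_Comp: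
  assumes "f \<in> Arr (kleisli C M)" "v \<in> Arr C" "kcod f = Dom C v"
  shows "kleisli_J C M v \<cdot>\<^bsub>kleisli C M\<^esub> f = KArr (kdom f) (Cod C v) (MA M v \<cdot> kmor f)"
  using assms by (simp add: kleisli_Comp kleisli_Arr Mu_MA_Eta_Comp)

text \<open>Naturality moves the unit to the left of \<open>kmor g\<close>, next to the
  multiplication, where the other unit law cancels both.\<close>

lemma kleisli_Comp_J:
  assumes "g \<in> Arr (kleisli C M)" "v \<in> Arr C" "kdom g = Cod C v"
  shows "g \<cdot>\<^bsub>kleisli C M\<^esub> kleisli_J C M v = KArr (Dom C v) (kcod g) (kmor g \<cdot> v)"
proof -
  have "MA M (kmor g) \<cdot> Eta M (Cod C v) \<cdot> v = Eta M (MO M (kcod g)) \<cdot> kmor g \<cdot> v"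
    using assms Eta_Comp[of "kmor g" "MO M (kcod g)"]
    by (simp add: kleisli_Arr flip: Comp_assoc_simp)
  then show ?thesis
    using assms by (simp add: kleisli_Comp kleisli_Arr Mu_Eta_Comp)
qed

lemma kleisli_J_Comp:
  assumes "v \<in> Arr C" "w \<in> Arr C" "Cod C v = Dom C w"
  shows "kleisli_J C M w \<cdot>\<^bsub>kleisli C M\<^esub> kleisli_J C M v = kleisli_J C M (w \<cdot> v)"
  by (subst kleisli_Comp_J) (use assms in \<open>simp_all add: kleisli_J_Arr kleisli_J_def[of _ _ "w \<cdot> v"]\<close>)

lemma kleisli_J_Ide: "X \<in> Obj C \<Longrightarrow> kleisli_J C M (Ide C X) = KArr X X (Eta M X)"
  by (simp add: kleisli_J_def)

lemma category_kleisli: "category (kleisli C M)"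
proof
  fix f X Y
  assume f: "f \<in> hom (kleisli C M) X Y"
  show "f \<cdot>\<^bsub>kleisli C M\<^esub> Ide (kleisli C M) X = f"
    using f kleisli_Comp_J[of f "Ide C X"]
    by (cases f) (simp add: hom_iff kleisli_Arr kleisli_J_Ide)
  show "Ide (kleisli C M) Y \<cdot>\<^bsub>kleisli C M\<^esub> f = f"
    using f J_kleisli_Comp[of f "Ide C Y"]
    by (cases f) (simp add: hom_iff kleisli_Arr kleisli_J_Ide)
next
  fix f g h W X Y Z
  assume "f \<in> hom (kleisli C M) W X" "g \<in> hom (kleisli C M) X Y" "h \<in> hom (kleisli C M) Y Z"
  then obtain f0 g0 h0 where f: "f = KArr W X f0" and g: "g = KArr X Y g0" and h: "h = KArr Y Z h0"
    and hom [simp]: "f0 \<in> Arr C" "Dom C f0 = W" "Cod C f0 = MO M X" "g0 \<in> Arr C" "Dom C g0 = X"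
      "Cod C g0 = MO M Y" "h0 \<in> Arr C" "Dom C h0 = Y" "Cod C h0 = MO M Z"
      "X \<in> Obj C" "Y \<in> Obj C" "Z \<in> Obj C"
    by (cases f; cases g; cases h) (auto simp: hom_iff kleisli_Arr)
  \<comment> \<open>Expanded, the two bracketings differ only in the place of the multiplications:
    associativity of \<open>Mu\<close> followed by its naturality at \<open>h0\<close> turns one
    into the other.\<close>
  have "Mu M Z \<cdot> MA M (Mu M Z) \<cdot> MA M (MA M h0) \<cdot> MA M g0 \<cdot> f0 =
      (Mu M Z \<cdot> MA M (Mu M Z)) \<cdot> MA M (MA M h0) \<cdot> MA M g0 \<cdot> f0"
    by simp
  also have "\<dots> = (Mu M Z \<cdot> Mu M (MO M Z)) \<cdot> MA M (MA M h0) \<cdot> MA M g0 \<cdot> f0"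
    by (simp only: Mu_Mu hom)
  also have "\<dots> = Mu M Z \<cdot> (Mu M (MO M Z) \<cdot> MA M (MA M h0)) \<cdot> MA M g0 \<cdot> f0"
    by simp
  also have "Mu M (MO M Z) \<cdot> MA M (MA M h0) = MA M h0 \<cdot> Mu M Y"
    using MA_Mu[of h0 Y] by simp
  finally show "(h \<cdot>\<^bsub>kleisli C M\<^esub> g) \<cdot>\<^bsub>kleisli C M\<^esub> f = h \<cdot>\<^bsub>kleisli C M\<^esub> g \<cdot>\<^bsub>kleisli C M\<^esub> f"
    by (simp add: f g h kleisli_Comp)
qed (auto simp: hom_iff kleisli_Arr kleisli_Comp)

lemma wide_subcategory_kleisli_pure: "wide_subcategory (kleisli C M) (kleisli_pure C M)"
proof -
  have "KArr X X (Eta M X) \<in> kleisli_pure C M" if "X \<in> Obj C" for X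
    using that kleisli_J_Ide[of X] by (auto simp: kleisli_pure_def image_iff intro!: bexI[of _ "Ide C X"])
  then show ?thesis
    by (auto simp: wide_subcategory_def kleisli_pure_def kleisli_J_Arr kleisli_J_Comp)
qed

text \<open>Turns questions about pure hom sets into questions about \<open>C\<close>; terminality
  and products are transported through it.\<close>

lemma hom_subcat_kleisli_pure:
  "hom (subcat (kleisli C M) (kleisli_pure C M)) X Y = kleisli_J C M ` hom C X Y"
  by (auto simp: hom_iff subcat_def kleisli_pure_def)

text \<open>Equal images have equal stored endpoints and equal composites with the same unit, which
  is mono.\<close>

lemma kleisli_J_inj:
  assumes "\<And>X. X \<in> Obj C \<Longrightarrow> mono_arrow C (Eta M X)" "v \<in> Arr C" "w \<in> Arr C"
    "kleisli_J C M v = kleisli_J C M w"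
  shows "v = w"
  using assms(1)[of "Cod C w"] assms(2-) by (auto simp: mono_arrow_def kleisli_J_def hom_iff)

end

subsection \<open>Strengths\<close>

context strong_monad
begin

lemma t_simps [simp]:
  assumes "X \<in> Obj C" "Y \<in> Obj C"
  shows "t X Y \<in> Arr C" "Dom C (t X Y) = Prd S X (MO M Y)" "Cod C (t X Y) = MO M (Prd S X Y)"
  using t_hom[OF assms] by (auto simp: hom_iff)

text \<open>The second projection factors as the left unit isomorphism of \<open>Y\<close> after
  \<open>?b\<close>. Naturality carries \<open>?b\<close> across the strength, and the unit axiom
  finishes.\<close>

lemma MA_Pr2_t:
  assumes "X \<in> Obj C" "Y \<in> Obj C"
  shows "MA M (Pr2 S X Y) \<cdot> t X Y = Pr2 S X (MO M Y)"
proof -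
  let ?b = "times C S (bang C (One S) X) (Ide C Y)"
  have "Pr2 S X Y = Pr2 S (One S) Y \<cdot> ?b"
    using assms by simp
  then have "MA M (Pr2 S X Y) \<cdot> t X Y = MA M (Pr2 S (One S) Y) \<cdot> MA M ?b \<cdot> t X Y"
    using assms MA_Comp_simp[of ?b "Pr2 S (One S) Y"] by simp
  also have "MA M ?b \<cdot> t X Y =
      t (One S) Y \<cdot> times C S (bang C (One S) X) (MA M (Ide C Y))"
    by (rule t_natural) (use assms in \<open>auto simp: hom_iff\<close>)
  also have "MA M (Pr2 S (One S) Y) \<cdot> \<dots> =
      (MA M (Pr2 S (One S) Y) \<cdot> t (One S) Y) \<cdot> times C S (bang C (One S) X) (MA M (Ide C Y))"
    using assms by simp
  also have "\<dots> = Pr2 S X (MO M Y)"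
    using assms by (subst t_unit) simp_all
  finally show ?thesis .
qed

text \<open>The axiom \<open>t_Eta\<close> precomposed with a product of morphisms; it makes Kleisli
  products of pure morphisms pure.\<close>

lemma t_times_Eta:
  assumes "v \<in> Arr C" "w \<in> Arr C" "Cod C v = X" "Cod C w = Y"
  shows "t X Y \<cdot> times C S v (Eta M Y \<cdot> w) = Eta M (Prd S X Y) \<cdot> times C S v w"
proof -
  have "times C S v (Eta M Y \<cdot> w) = times C S (Ide C X) (Eta M Y) \<cdot> times C S v w"
    using assms by (subst times_Comp) auto
  moreover have "t X Y \<cdot> times C S (Ide C X) (Eta M Y) = Eta M (Prd S X Y)"
    using assms by (intro t_Eta) auto
  ultimately show ?thesis
    using assms Comp_assoc_simp[of "times C S v w" "times C S (Ide C X) (Eta M Y)" "t X Y"]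
    by auto
qed

end

subsection \<open>Consistency relations on Kleisli categories\<close>

locale kleisli_consistency = strong_monad +
  fixes R :: "('a, 'b) karr \<Rightarrow> ('a, 'b) karr \<Rightarrow> bool"
  assumes Eta_mono: "X \<in> Obj C \<Longrightarrow> mono_arrow C (Eta M X)"
    and consistency: "consistency_relation (kleisli C M) (kleisli_pure C M) R"
begin

abbreviation K where "K \<equiv> kleisli C M"
abbreviation P where "P \<equiv> kleisli_pure C M"
abbreviation J where "J \<equiv> kleisli_J C M"
abbreviation SK where "SK \<equiv> kleisli_products C S M"
abbreviation lt where "lt \<equiv> kleisli_left C S M t"
abbreviation rt where "rt \<equiv> kleisli_right C S M t"

sublocale K: category K
  by (rule category_kleisli)

lemma J_eq_iff: "v \<in> Arr C \<Longrightarrow> w \<in> Arr C \<Longrightarrow> J v = J w \<longleftrightarrow> v = w"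
  using kleisli_J_inj[OF Eta_mono] by blast

text \<open>Faithfulness of \<open>J\<close> gives the uniqueness behind the definite description.
  Pure arguments of the Kleisli products are written as \<open>J v\<close> below so that this rule
  computes them.\<close>

lemma pure_part_J [simp]: "v \<in> Arr C \<Longrightarrow> pure_part C M (J v) = v"
  unfolding pure_part_def by (rule the_equality) (auto simp: J_eq_iff)

lemma R_precomp:
  assumes "R g w" "v \<in> Arr C" "Cod C v = kdom g"
  shows "R (g \<cdot>\<^bsub>K\<^esub> J v) (w \<cdot>\<^bsub>K\<^esub> J v)"
  using K.consistency_relation_precomp[OF wide_subcategory_kleisli_pure consistency, of g w "J v"] assms
  by (simp add: kleisli_pure_def)

section \<open>The Cartesian structure of the pure morphisms\<close>

lemma SK_simps [simp]:
  "One SK = One S" "Prd SK = Prd S" "Pr1 SK X Y = J (Pr1 S X Y)" "Pr2 SK X Y = J (Pr2 S X Y)"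
  by (simp_all add: kleisli_products_def)

lemma terminal_pure: "terminal (subcat K P) (One S)"
proof -
  have "\<exists>!f. f \<in> hom (subcat K P) X (One S)" if "X \<in> Obj C" for X
    using that unfolding hom_subcat_kleisli_pure
    by (intro ex1I[of _ "J (bang C (One S) X)"]) (auto simp: bang_hom hom_iff bang_unique)
  then show ?thesis
    by (simp add: terminal_def) (simp add: subcat_def)
qed

lemma bang_pure: "X \<in> Obj C \<Longrightarrow> bang (subcat K P) (One S) X = J (bang C (One S) X)"
  unfolding bang_def[of "subcat K P"] hom_subcat_kleisli_pure
  by (rule the_equality) (auto simp: hom_iff bang_unique)

text \<open>The universal property is carried along \<open>J\<close>, which is faithful, respects
  composition and is onto the pure hom sets.\<close>

lemma cartesian_pure: "cartesian_category (subcat K P) SK"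
proof -
  interpret sub: category "subcat K P"
    by (rule K.category_subcat[OF wide_subcategory_kleisli_pure])
  have Comp [simp]: "Comp (subcat K P) = Comp K" and Obj [simp]: "Obj (subcat K P) = Obj C"
    by (auto simp: subcat_def)
  show ?thesis
  proof
    fix X Y Z f g
    assume XY: "X \<in> Obj (subcat K P)" "Y \<in> Obj (subcat K P)"
      and "f \<in> hom (subcat K P) Z X" "g \<in> hom (subcat K P) Z Y"
    then obtain f0 g0 where fg: "f = J f0" "g = J g0" "f0 \<in> hom C Z X" "g0 \<in> hom C Z Y"
      by (auto simp: hom_subcat_kleisli_pure)
    \<comment> \<open>Candidates for the mediating morphism correspond under \<open>J\<close>. Those
      outside the hom set are treated apart, since the composition rule for \<open>J\<close> needs
      composable factors; there both sides are false.\<close>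
    have *: "J h0 \<in> hom (subcat K P) Z (Prd SK X Y) \<and> Pr1 SK X Y \<cdot>\<^bsub>subcat K P\<^esub> J h0 = f \<and>
        Pr2 SK X Y \<cdot>\<^bsub>subcat K P\<^esub> J h0 = g \<longleftrightarrow>
      h0 \<in> hom C Z (Prd S X Y) \<and> Pr1 S X Y \<cdot> h0 = f0 \<and> Pr2 S X Y \<cdot> h0 = g0"
      if "h0 \<in> Arr C" for h0
    proof (cases "h0 \<in> hom C Z (Prd S X Y)")
      case True
      then show ?thesis
        using XY fg by (auto simp: hom_iff hom_subcat_kleisli_pure kleisli_J_Comp J_eq_iff)
    next
      case False
      then have "J h0 \<notin> hom (subcat K P) Z (Prd S X Y)"
        using that by (auto simp: hom_iff subcat_def)
      then show ?thesis using False by simp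
    qed
    have "\<exists>!h0. h0 \<in> hom C Z (Prd S X Y) \<and> Pr1 S X Y \<cdot> h0 = f0 \<and> Pr2 S X Y \<cdot> h0 = g0"
      using XY fg by (intro Prd_universal) auto
    then obtain h0 where h0: "h0 \<in> hom C Z (Prd S X Y) \<and> Pr1 S X Y \<cdot> h0 = f0 \<and> Pr2 S X Y \<cdot> h0 = g0"
      and uniq: "\<And>k. k \<in> hom C Z (Prd S X Y) \<and> Pr1 S X Y \<cdot> k = f0 \<and> Pr2 S X Y \<cdot> k = g0 \<Longrightarrow> k = h0"
      by blast
    show "\<exists>!h. h \<in> hom (subcat K P) Z (Prd SK X Y) \<and> Pr1 SK X Y \<cdot>\<^bsub>subcat K P\<^esub> h = f \<and>
        Pr2 SK X Y \<cdot>\<^bsub>subcat K P\<^esub> h = g"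
    proof (rule ex1I[of _ "J h0"])
      show "J h0 \<in> hom (subcat K P) Z (Prd SK X Y) \<and> Pr1 SK X Y \<cdot>\<^bsub>subcat K P\<^esub> J h0 = f \<and>
          Pr2 SK X Y \<cdot>\<^bsub>subcat K P\<^esub> J h0 = g"
        using h0 by (subst *) (auto simp: hom_iff)
    next
      fix h
      assume h: "h \<in> hom (subcat K P) Z (Prd SK X Y) \<and> Pr1 SK X Y \<cdot>\<^bsub>subcat K P\<^esub> h = f \<and>
          Pr2 SK X Y \<cdot>\<^bsub>subcat K P\<^esub> h = g"
      then obtain k where "h = J k" "k \<in> Arr C"
        by (auto simp: hom_subcat_kleisli_pure hom_iff)
      then show "h = J h0" using h uniq *[of k] by simp
    qed
  qed (auto simp: terminal_pure hom_subcat_kleisli_pure Pr1_hom Pr2_hom)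
qed

sublocale sub: cartesian_category "subcat K P" SK
  by (rule cartesian_pure)

text \<open>Both sides are pure and have the same two projections, so the products of the pure
  subcategory identify them.\<close>

lemma times_pure:
  assumes "v \<in> Arr C" "w \<in> Arr C"
  shows "times (subcat K P) SK (J v) (J w) = J (times C S v w)"
proof -
  have [simp]: "Comp (subcat K P) = Comp K" "Obj (subcat K P) = Obj C" "Arr (subcat K P) = P"
    "Dom (subcat K P) = kdom" "Cod (subcat K P) = kcod"
    by (auto simp: subcat_def)
  have [simp]: "J u \<in> P" if "u \<in> Arr C" for u
    using that by (simp add: kleisli_pure_def)
  show ?thesis
  proof (rule sub.Prd_eqI[of _ _ "Cod C v" "Cod C w"])
    show "Pr1 SK (Cod C v) (Cod C w) \<cdot>\<^bsub>subcat K P\<^esub> times (subcat K P) SK (J v) (J w) =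
      Pr1 SK (Cod C v) (Cod C w) \<cdot>\<^bsub>subcat K P\<^esub> J (times C S v w)"
      using sub.times_simps(4)[of "J v" "J w" "Cod C v" "Cod C w"] assms
      by (simp add: kleisli_J_Comp)
    show "Pr2 SK (Cod C v) (Cod C w) \<cdot>\<^bsub>subcat K P\<^esub> times (subcat K P) SK (J v) (J w) =
      Pr2 SK (Cod C v) (Cod C w) \<cdot>\<^bsub>subcat K P\<^esub> J (times C S v w)"
      using sub.times_simps(5)[of "J v" "J w" "Cod C v" "Cod C w"] assms
      by (simp add: kleisli_J_Comp)
  qed (use assms sub.times_simps(1-3)[of "J v" "J w"] in auto)
qed

text \<open>The other clauses of an effect category hold under the standing hypotheses.\<close>

lemma effect_category_iff: "effect_category K P (One SK) R \<longleftrightarrow> complementarity K P (One SK) R"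
  by (simp add: effect_category_def category_kleisli wide_subcategory_kleisli_pure
      terminal_pure consistency)

section \<open>The strength condition and the Kleisli products\<close>

abbreviation strength_consistent where
  "strength_consistent \<equiv> \<forall>Y1 \<in> Obj C. \<forall>Y2 \<in> Obj C.
    R (Pr1 SK Y1 Y2 \<cdot>\<^bsub>K\<^esub> KArr (Prd S Y1 (MO M Y2)) (Prd S Y1 Y2) (t Y1 Y2))
      (Pr1 SK Y1 (MO M Y2))"

lemma Pr1_strength:
  assumes "Y1 \<in> Obj C" "Y2 \<in> Obj C"
  shows "Pr1 SK Y1 Y2 \<cdot>\<^bsub>K\<^esub> KArr (Prd S Y1 (MO M Y2)) (Prd S Y1 Y2) (t Y1 Y2) =
    KArr (Prd S Y1 (MO M Y2)) Y1 (MA M (Pr1 S Y1 Y2) \<cdot> t Y1 Y2)"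
  using assms by (simp add: J_kleisli_Comp kleisli_Arr)

lemma left_eq:
  assumes "v \<in> Arr C" "f \<in> Arr K"
  shows "lt (J v) f = KArr (Prd S (Dom C v) (kdom f)) (Prd S (Cod C v) (kcod f))
    (t (Cod C v) (kcod f) \<cdot> times C S v (kmor f))"
  using assms by (simp add: kleisli_left_def)

lemma left_Arr: "v \<in> Arr C \<Longrightarrow> f \<in> Arr K \<Longrightarrow> lt (J v) f \<in> Arr K"
  by (simp add: left_eq kleisli_Arr)

text \<open>The identity of \<open>MO M Y2\<close>, read as a Kleisli morphism to \<open>Y2\<close>,
  exhibits the strength as a left product. The left property of this product gives back the strength
  condition.\<close>

lemma left_strength:
  assumes "Y1 \<in> Obj C" "Y2 \<in> Obj C"
  shows "lt (J (Ide C Y1)) (KArr (MO M Y2) Y2 (Ide C (MO M Y2))) =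
    KArr (Prd S Y1 (MO M Y2)) (Prd S Y1 Y2) (t Y1 Y2)"
  using assms by (simp add: left_eq kleisli_Arr times_Ide_Ide)

text \<open>Naturality of the swap moves it past the product of morphisms, so that the strength
  inside \<open>costrength\<close> meets the factors in the order of the left product.\<close>

lemma right_eq_left:
  assumes "v \<in> Arr C" "f \<in> Arr K"
  shows "rt f (J v) = KArr (Prd S (kdom f) (Dom C v)) (Prd S (kcod f) (Cod C v))
    (MA M (swap C S (Cod C v) (kcod f)) \<cdot> kmor (lt (J v) f) \<cdot> swap C S (kdom f) (Dom C v))"
proof -
  have "swap C S (MO M (kcod f)) (Cod C v) \<cdot> times C S (kmor f) v =
      times C S v (kmor f) \<cdot> swap C S (kdom f) (Dom C v)"
    using assms swap_times[of "kmor f" v "MO M (kcod f)" "Cod C v"] by (simp add: kleisli_Arr)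
  then show ?thesis
    using assms by (simp add: kleisli_right_def costrength_def left_eq kleisli_Arr)
qed

lemma right_Arr: "v \<in> Arr C \<Longrightarrow> f \<in> Arr K \<Longrightarrow> rt f (J v) \<in> Arr K"
  by (simp add: right_eq_left kleisli_Arr left_eq)

lemma right_prod_hom:
  assumes "v \<in> Arr C" "f \<in> Arr K"
  shows "rt f (J v) \<in> prod_hom K SK f (J v)"
  using right_Arr[OF assms] assms by (simp add: prod_hom_def hom_iff right_eq_left)

lemma left_prod_hom:
  assumes "v \<in> Arr C" "f \<in> Arr K"
  shows "lt (J v) f \<in> prod_hom K SK (J v) f"
  using left_Arr[OF assms] assms by (simp add: prod_hom_def hom_iff left_eq)

text \<open>By \<open>MA_Pr2_t\<close> the strength drops out. The same equation later yields the
  first projection of the right product.\<close>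

lemma Pr2_left:
  assumes "v \<in> Arr C" "f \<in> Arr K"
  shows "MA M (Pr2 S (Cod C v) (kcod f)) \<cdot> kmor (lt (J v) f) = kmor f \<cdot> Pr2 S (Dom C v) (kdom f)"
proof -
  have "MA M (Pr2 S (Cod C v) (kcod f)) \<cdot> kmor (lt (J v) f) =
    (MA M (Pr2 S (Cod C v) (kcod f)) \<cdot> t (Cod C v) (kcod f)) \<cdot> times C S v (kmor f)"
    using assms by (simp add: left_eq kleisli_Arr)
  also have "\<dots> = Pr2 S (Cod C v) (MO M (kcod f)) \<cdot> times C S v (kmor f)"
    using assms by (simp add: MA_Pr2_t kleisli_Arr)
  finally show ?thesis using assms by (simp add: kleisli_Arr)
qed

lemma Pr1_left:
  assumes pure: strength_consistent and v: "v \<in> Arr C" and f: "f \<in> Arr K"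
  shows "R (Pr1 SK (Cod C v) (kcod f) \<cdot>\<^bsub>K\<^esub> lt (J v) f) (J v \<cdot>\<^bsub>K\<^esub> Pr1 SK (Dom C v) (kdom f))"
proof -
  let ?t = "KArr (Prd S (Cod C v) (MO M (kcod f))) (Prd S (Cod C v) (kcod f)) (t (Cod C v) (kcod f))"
  let ?u = "times C S v (kmor f)"
  have f0: "kdom f \<in> Obj C" "kcod f \<in> Obj C" "kmor f \<in> Arr C" "Dom C (kmor f) = kdom f"
      "Cod C (kmor f) = MO M (kcod f)"
    using f by (auto simp: kleisli_Arr)
  have "R (Pr1 SK (Cod C v) (kcod f) \<cdot>\<^bsub>K\<^esub> ?t) (Pr1 SK (Cod C v) (MO M (kcod f)))"
    using pure Cod_Obj[OF v] f0(2) by blast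
  \<comment> \<open>\<open>?u\<close> is a morphism of \<open>C\<close> even if \<open>f\<close> is
    not pure, because it treats \<open>kmor f\<close> as an ordinary morphism into
    \<open>MO M (kcod f)\<close>; so \<open>J ?u\<close> is pure and precomposition is
    allowed.\<close>
  then have "R ((Pr1 SK (Cod C v) (kcod f) \<cdot>\<^bsub>K\<^esub> ?t) \<cdot>\<^bsub>K\<^esub> J ?u)
      (Pr1 SK (Cod C v) (MO M (kcod f)) \<cdot>\<^bsub>K\<^esub> J ?u)"
    by (rule R_precomp) (use v f0 in \<open>simp_all add: kleisli_Comp\<close>)
  moreover have "Pr1 SK (Cod C v) (MO M (kcod f)) \<cdot>\<^bsub>K\<^esub> J ?u = J v \<cdot>\<^bsub>K\<^esub> Pr1 SK (Dom C v) (kdom f)"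
    using v f0 by (simp add: kleisli_J_Comp)
  moreover have "(Pr1 SK (Cod C v) (kcod f) \<cdot>\<^bsub>K\<^esub> ?t) \<cdot>\<^bsub>K\<^esub> J ?u =
      Pr1 SK (Cod C v) (kcod f) \<cdot>\<^bsub>K\<^esub> lt (J v) f"
    using v f f0 left_Arr[OF v f]
    by (simp add: J_kleisli_Comp kleisli_Comp_J kleisli_Arr left_eq)
  ultimately show ?thesis by simp
qed

lemma left_property_left:
  assumes strength_consistent "v \<in> Arr C" "f \<in> Arr K"
  shows "left_property K SK R (J v) f (lt (J v) f)"
proof -
  have "Pr2 SK (Cod C v) (kcod f) \<cdot>\<^bsub>K\<^esub> lt (J v) f = f \<cdot>\<^bsub>K\<^esub> Pr2 SK (Dom C v) (kdom f)"
    using assms(2,3) left_Arr[OF assms(2,3)] Pr2_left[OF assms(2,3)]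
      J_kleisli_Comp[of "lt (J v) f" "Pr2 S (Cod C v) (kcod f)"]
      kleisli_Comp_J[of f "Pr2 S (Dom C v) (kdom f)"]
    by (simp add: kleisli_Arr[of f]) (simp add: left_eq kleisli_Arr[of f])
  then show ?thesis
    using Pr1_left[OF assms] by (simp add: left_property_def)
qed

lemma right_property_right:
  assumes pure: strength_consistent and v: "v \<in> Arr C" and f: "f \<in> Arr K"
  shows "right_property K SK R f (J v) (rt f (J v))"
proof -
  let ?s = "swap C S (kdom f) (Dom C v)" and ?s' = "swap C S (Cod C v) (kcod f)"
  let ?l = "kmor (lt (J v) f)"
  have f0: "kdom f \<in> Obj C" "kcod f \<in> Obj C" "kmor f \<in> Arr C" "Dom C (kmor f) = kdom f"
      "Cod C (kmor f) = MO M (kcod f)"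
    using f by (auto simp: kleisli_Arr)
  have l: "?l \<in> Arr C" "Dom C ?l = Prd S (Dom C v) (kdom f)"
      "Cod C ?l = MO M (Prd S (Cod C v) (kcod f))" "kdom (lt (J v) f) = Prd S (Dom C v) (kdom f)"
      "kcod (lt (J v) f) = Prd S (Cod C v) (kcod f)"
    using v f f0 by (simp_all add: left_eq)
  have r: "rt f (J v) = KArr (Prd S (kdom f) (Dom C v)) (Prd S (kcod f) (Cod C v))
      (MA M ?s' \<cdot> ?l \<cdot> ?s)"
    by (rule right_eq_left[OF v f])
  \<comment> \<open>Functoriality merges the projection with \<open>?s'\<close>, which exchanges the
    two projections. \<open>MA_Comp_simp\<close> is switched off because it would undo the
    merge.\<close>
  have swap1: "MA M (Pr1 S (kcod f) (Cod C v)) \<cdot> MA M ?s' \<cdot> ?l \<cdot> ?s =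
      (MA M (Pr2 S (Cod C v) (kcod f)) \<cdot> ?l) \<cdot> ?s"
    using v f0 l by (simp add: MA_Comp_Comp del: MA_Comp_simp)
  have swap2: "MA M (Pr2 S (kcod f) (Cod C v)) \<cdot> MA M ?s' \<cdot> ?l \<cdot> ?s =
      (MA M (Pr1 S (Cod C v) (kcod f)) \<cdot> ?l) \<cdot> ?s"
    using v f0 l by (simp add: MA_Comp_Comp del: MA_Comp_simp)
  have "Pr1 SK (kcod f) (Cod C v) \<cdot>\<^bsub>K\<^esub> rt f (J v) =
      KArr (Prd S (kdom f) (Dom C v)) (kcod f)
        (MA M (Pr1 S (kcod f) (Cod C v)) \<cdot> MA M ?s' \<cdot> ?l \<cdot> ?s)"
    using v f0 right_Arr[OF v f] by (simp add: J_kleisli_Comp r)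
  also have "\<dots> = f \<cdot>\<^bsub>K\<^esub> Pr1 SK (kdom f) (Dom C v)"
    unfolding swap1 Pr2_left[OF v f] using v f f0 by (simp add: kleisli_Comp_J)
  finally have 1: "Pr1 SK (kcod f) (Cod C v) \<cdot>\<^bsub>K\<^esub> rt f (J v) = f \<cdot>\<^bsub>K\<^esub> Pr1 SK (kdom f) (Dom C v)" .
  \<comment> \<open>The relation known for the left product, precomposed with the pure swap; the
    equations that follow rewrite its two sides into the required ones.\<close>
  have "R ((Pr1 SK (Cod C v) (kcod f) \<cdot>\<^bsub>K\<^esub> lt (J v) f) \<cdot>\<^bsub>K\<^esub> J ?s)
      ((J v \<cdot>\<^bsub>K\<^esub> Pr1 SK (Dom C v) (kdom f)) \<cdot>\<^bsub>K\<^esub> J ?s)"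
    by (rule R_precomp[OF Pr1_left[OF pure v f]]) (use v f0 l in \<open>simp_all add: kleisli_Comp\<close>)
  moreover have "(J v \<cdot>\<^bsub>K\<^esub> Pr1 SK (Dom C v) (kdom f)) \<cdot>\<^bsub>K\<^esub> J ?s =
      J v \<cdot>\<^bsub>K\<^esub> Pr2 SK (kdom f) (Dom C v)"
    using v f0 by (simp add: kleisli_J_Comp)
  moreover have "(Pr1 SK (Cod C v) (kcod f) \<cdot>\<^bsub>K\<^esub> lt (J v) f) \<cdot>\<^bsub>K\<^esub> J ?s =
      KArr (Prd S (kdom f) (Dom C v)) (Cod C v) ((MA M (Pr1 S (Cod C v) (kcod f)) \<cdot> ?l) \<cdot> ?s)"
    using v f0 l left_Arr[OF v f] by (simp add: J_kleisli_Comp kleisli_Comp_J kleisli_Arr)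
  moreover have "\<dots> = Pr2 SK (kcod f) (Cod C v) \<cdot>\<^bsub>K\<^esub> rt f (J v)"
    unfolding swap2[symmetric] using v f0 right_Arr[OF v f] by (simp add: J_kleisli_Comp r)
  ultimately have "R (Pr2 SK (kcod f) (Cod C v) \<cdot>\<^bsub>K\<^esub> rt f (J v)) (J v \<cdot>\<^bsub>K\<^esub> Pr2 SK (kdom f) (Dom C v))"
    by simp
  with 1 show ?thesis by (simp add: right_property_def)
qed

text \<open>Complementarity belongs to the notion of effect category and does not mention
  \<open>t\<close>; it therefore stands beside the strength condition as a conjunct of its
  own.\<close>

lemma weak_iff:
  "weak_cartesian_effect_category K P SK R lt rt \<longleftrightarrow> complementarity K P (One SK) R \<and> strength_consistent"
proof
  assume weak: "weak_cartesian_effect_category K P SK R lt rt"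
  have strength_consistent
  proof (intro ballI)
    fix Y1 Y2
    assume Y: "Y1 \<in> Obj C" "Y2 \<in> Obj C"
    let ?f = "KArr (MO M Y2) Y2 (Ide C (MO M Y2))"
    have f: "?f \<in> Arr K" using Y by (simp add: kleisli_Arr)
    have "J (Ide C Y1) \<in> P" using Y by (simp add: kleisli_pure_def)
    then have "left_property K SK R (J (Ide C Y1)) ?f (lt (J (Ide C Y1)) ?f)"
      using weak f unfolding weak_cartesian_effect_category_def by blast
    then show "R (Pr1 SK Y1 Y2 \<cdot>\<^bsub>K\<^esub> KArr (Prd S Y1 (MO M Y2)) (Prd S Y1 Y2) (t Y1 Y2))
        (Pr1 SK Y1 (MO M Y2))"
      unfolding left_strength[OF Y] using Y by (simp add: left_property_def kleisli_J_Comp)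
  qed
  then show "complementarity K P (One SK) R \<and> strength_consistent"
    using weak by (simp add: weak_cartesian_effect_category_def effect_category_iff[simplified])
next
  assume *: "complementarity K P (One SK) R \<and> strength_consistent"
  have "lt v f \<in> prod_hom K SK v f \<and> left_property K SK R v f (lt v f) \<and>
      rt f v \<in> prod_hom K SK f v \<and> right_property K SK R f v (rt f v)"
    if v: "v \<in> P" and f: "f \<in> Arr K" for v f
  proof -
    obtain v0 where "v = J v0" "v0 \<in> Arr C"
      using v by (auto simp: kleisli_pure_def)
    then show ?thesis
      using f * left_property_left right_property_right left_prod_hom right_prod_hom by blast
  qed
  moreover have "effect_category K P (One SK) R"
    using * effect_category_iff by blast
  ultimately show "weak_cartesian_effect_category K P SK R lt rt"
    unfolding weak_cartesian_effect_category_def using cartesian_pure by blast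
qed

text \<open>\<open>J w\<close> consists of the endpoints of \<open>w\<close> and its composite with
  the unit, so every witness of \<open>rel0\<close> has the same image under \<open>J\<close> as the
  projection.\<close>

lemma strength_iff_rel0:
  assumes "Y1 \<in> Obj C" "Y2 \<in> Obj C"
  shows "R (Pr1 SK Y1 Y2 \<cdot>\<^bsub>K\<^esub> KArr (Prd S Y1 (MO M Y2)) (Prd S Y1 Y2) (t Y1 Y2))
      (Pr1 SK Y1 (MO M Y2)) \<longleftrightarrow>
    rel0 C M R (Prd S Y1 (MO M Y2)) Y1
      (MA M (Pr1 S Y1 Y2) \<cdot> t Y1 Y2) (Eta M Y1 \<cdot> Pr1 S Y1 (MO M Y2))"
proof -
  have "R (KArr X Y1 \<phi>) (J w) \<longleftrightarrow> rel0 C M R X Y1 \<phi> (Eta M Y1 \<cdot> w)"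
    if w: "w \<in> hom C X Y1" for X w \<phi>
  proof -
    have "J v = J w" if "v \<in> hom C X Y1" "Eta M Y1 \<cdot> w = Eta M Y1 \<cdot> v" for v
      using that w by (simp add: kleisli_J_def hom_iff)
    then show ?thesis
      unfolding rel0_def using w by metis
  qed
  then show ?thesis
    unfolding Pr1_strength[OF assms] using Pr1_hom[of Y1 "MO M Y2"] assms by simp
qed

section \<open>Joint cancellation of the projections and complementarity\<close>

abbreviation jointly_monic where
  "jointly_monic \<equiv> \<forall>X \<in> Obj C. \<forall>Y1 \<in> Obj C. \<forall>Y2 \<in> Obj C.
    \<forall>\<phi> \<in> hom C X (MO M (Prd S Y1 Y2)). \<forall>\<phi>' \<in> hom C X (MO M (Prd S Y1 Y2)).
      consistent0 C M R X Y1 (MA M (Pr1 S Y1 Y2) \<cdot> \<phi>) (MA M (Pr1 S Y1 Y2) \<cdot> \<phi>') \<and>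
      MA M (Pr2 S Y1 Y2) \<cdot> \<phi> = MA M (Pr2 S Y1 Y2) \<cdot> \<phi>' \<longrightarrow> \<phi> = \<phi>'"

text \<open>The hypothesis read in \<open>K\<close>, where applying \<open>MA M\<close> of a
  projection is composition with the pure projection. Consistency replaces equality in the first
  component, so this differs from plain joint monicity.\<close>

lemma jointly_monicD:
  assumes monic: jointly_monic and Y: "Y1 \<in> Obj C" "Y2 \<in> Obj C"
    and h: "h \<in> hom K X (Prd S Y1 Y2)" "h' \<in> hom K X (Prd S Y1 Y2)"
    and c: "consistent P R (J (Pr1 S Y1 Y2) \<cdot>\<^bsub>K\<^esub> h) (J (Pr1 S Y1 Y2) \<cdot>\<^bsub>K\<^esub> h')"
    and e: "J (Pr2 S Y1 Y2) \<cdot>\<^bsub>K\<^esub> h = J (Pr2 S Y1 Y2) \<cdot>\<^bsub>K\<^esub> h'"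
  shows "h = h'"
proof -
  have "h \<in> Arr K" "h' \<in> Arr K" "kdom h = X" "kdom h' = X"
      "kcod h = Prd S Y1 Y2" "kcod h' = Prd S Y1 Y2" "X \<in> Obj C"
    using h by (auto simp: hom_iff kleisli_Arr)
  note * = this
  have "kmor h \<in> hom C X (MO M (Prd S Y1 Y2))" "kmor h' \<in> hom C X (MO M (Prd S Y1 Y2))"
    using * by (auto simp: hom_iff kleisli_Arr)
  moreover have "consistent0 C M R X Y1 (MA M (Pr1 S Y1 Y2) \<cdot> kmor h) (MA M (Pr1 S Y1 Y2) \<cdot> kmor h')"
    using c * Y by (simp add: J_kleisli_Comp consistent0_def)
  moreover have "MA M (Pr2 S Y1 Y2) \<cdot> kmor h = MA M (Pr2 S Y1 Y2) \<cdot> kmor h'"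
    using e * Y by (simp add: J_kleisli_Comp)
  ultimately have "kmor h = kmor h'"
    using monic Y * by blast
  then show ?thesis using * by (simp add: karr.expand)
qed

lemma J_assoc:
  assumes "f \<in> Arr K" "v \<in> Arr C" "w \<in> Arr C" "kcod f = Dom C v" "Cod C v = Dom C w"
  shows "J w \<cdot>\<^bsub>K\<^esub> J v \<cdot>\<^bsub>K\<^esub> f = J (w \<cdot> v) \<cdot>\<^bsub>K\<^esub> f"
  using K.Comp_assoc_simp[of f "J v" "J w"] assms by (simp add: kleisli_J_Arr kleisli_J_Comp)

text \<open>\<open>J\<close> preserves the equation that makes \<open>w\<close> a retraction of
  \<open>v\<close>, so \<open>J v\<close> can be cancelled on the left in \<open>K\<close>. It
  serves for the swap and for the embedding of \<open>Y\<close> into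
  \<open>Y \<times> 1\<close>.\<close>

lemma J_section_cancel:
  assumes eq: "J v \<cdot>\<^bsub>K\<^esub> f = J v \<cdot>\<^bsub>K\<^esub> f'" and "w \<cdot> v = Ide C Y"
    and "f \<in> hom K X Y" "f' \<in> hom K X Y" "v \<in> hom C Y Z" "w \<in> hom C Z Y"
  shows "f = f'"
proof -
  have "J w \<cdot>\<^bsub>K\<^esub> J v \<cdot>\<^bsub>K\<^esub> g = g" if "g \<in> hom K X Y" for g
    using that assms(2,5,6) K.Comp_Ide_simps(2)[of g Y] kleisli_J_Ide[of Y] Cod_Obj[of w]
    by (auto simp: J_assoc hom_iff)
  then show ?thesis using assms by metis
qed

text \<open>Composition with the swap exchanges the projections, and the opposite swap is its
  retraction.\<close>

lemma jointly_monic_swapD: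
  assumes monic: jointly_monic and Y: "Y1 \<in> Obj C" "Y2 \<in> Obj C"
    and h: "h \<in> hom K X (Prd S Y1 Y2)" "h' \<in> hom K X (Prd S Y1 Y2)"
    and c: "consistent P R (J (Pr2 S Y1 Y2) \<cdot>\<^bsub>K\<^esub> h) (J (Pr2 S Y1 Y2) \<cdot>\<^bsub>K\<^esub> h')"
    and e: "J (Pr1 S Y1 Y2) \<cdot>\<^bsub>K\<^esub> h = J (Pr1 S Y1 Y2) \<cdot>\<^bsub>K\<^esub> h'"
  shows "h = h'"
proof (rule J_section_cancel[OF jointly_monicD[OF monic Y(2,1)] swap_swap[OF Y]])
  show "J (swap C S Y1 Y2) \<cdot>\<^bsub>K\<^esub> h \<in> hom K X (Prd S Y2 Y1)"
    "J (swap C S Y1 Y2) \<cdot>\<^bsub>K\<^esub> h' \<in> hom K X (Prd S Y2 Y1)"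
    using h Y by (simp_all add: hom_iff kleisli_J_Arr K.Comp_simps[simplified])
qed (use h c e Y in \<open>simp_all add: J_assoc hom_iff\<close>)

lemma jointly_monic_complementarity:
  assumes monic: jointly_monic
  shows "complementarity K P (One SK) R"
  unfolding complementarity_def
proof (intro allI impI)
  fix f f'
  assume par: "parallel K f f'" and eff: "same_effect K P (One SK) f f'"
    and c: "consistent P R f f'"
  let ?Y = "kcod f"
  \<comment> \<open>A section of the first projection of \<open>Y \<times> 1\<close>. After
    \<open>J ?v\<close>, the first projection returns the morphism itself and the second returns its
    effect, which matches the two premises on \<open>f\<close> and \<open>f'\<close>.\<close>
  let ?v = "pairing C S (Ide C ?Y) (bang C (One S) ?Y)"
  have f: "f \<in> hom K (kdom f) ?Y" "f' \<in> hom K (kdom f) ?Y" and Y: "?Y \<in> Obj C"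
    using par by (auto simp: parallel_def hom_iff kleisli_Arr)
  then have A: "f \<in> Arr K" "f' \<in> Arr K" "kdom f' = kdom f" "kcod f' = ?Y"
    by (auto simp: hom_iff)
  have id: "J (Ide C ?Y) \<cdot>\<^bsub>K\<^esub> g = g" if "g \<in> Arr K" "kcod g = ?Y" for g
    using K.Comp_Ide_simps(2)[of g ?Y] that Y by (simp add: kleisli_J_Ide)
  show "f = f'"
  proof (rule J_section_cancel[OF jointly_monicD[OF monic Y One_Obj] _ f])
    show "J ?v \<cdot>\<^bsub>K\<^esub> f \<in> hom K (kdom f) (Prd S ?Y (One S))"
      "J ?v \<cdot>\<^bsub>K\<^esub> f' \<in> hom K (kdom f) (Prd S ?Y (One S))"
      using A Y by (simp_all add: hom_iff kleisli_J_Arr K.Comp_simps[simplified])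
    show "Pr1 S ?Y (One S) \<cdot> ?v = Ide C ?Y"
      using Y by simp
    show "consistent P R (J (Pr1 S ?Y (One S)) \<cdot>\<^bsub>K\<^esub> J ?v \<cdot>\<^bsub>K\<^esub> f)
        (J (Pr1 S ?Y (One S)) \<cdot>\<^bsub>K\<^esub> J ?v \<cdot>\<^bsub>K\<^esub> f')"
      using A Y c id by (simp add: J_assoc)
    show "J (Pr2 S ?Y (One S)) \<cdot>\<^bsub>K\<^esub> J ?v \<cdot>\<^bsub>K\<^esub> f = J (Pr2 S ?Y (One S)) \<cdot>\<^bsub>K\<^esub> J ?v \<cdot>\<^bsub>K\<^esub> f'"
      using A Y eff by (simp add: J_assoc same_effect_def bang_pure)
  qed (use Y in \<open>simp_all add: hom_iff\<close>)
qed

section \<open>Extension of the Cartesian product and uniqueness\<close>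

lemma left_pure:
  assumes "v \<in> Arr C" "w \<in> Arr C"
  shows "lt (J v) (J w) = J (times C S v w)"
  using assms t_times_Eta[OF assms] by (simp add: left_eq kleisli_J_Arr) (simp add: kleisli_J_def)

text \<open>Naturality of the unit carries the outer swap inside; naturality of the swap then brings
  the two swaps together, where they cancel.\<close>

lemma right_pure:
  assumes v: "v \<in> Arr C" and w: "w \<in> Arr C"
  shows "rt (J v) (J w) = J (times C S v w)"
proof -
  let ?s = "swap C S (Dom C v) (Dom C w)" and ?s' = "swap C S (Cod C w) (Cod C v)"
  have "times C S w v \<cdot> ?s = swap C S (Cod C v) (Cod C w) \<cdot> times C S v w"
    using v w by (simp add: swap_times)
  then have "?s' \<cdot> times C S w v \<cdot> ?s = (?s' \<cdot> swap C S (Cod C v) (Cod C w)) \<cdot> times C S v w"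
    using v w by simp
  also have "\<dots> = times C S v w"
    using v w by (simp add: swap_swap)
  finally have s: "?s' \<cdot> times C S w v \<cdot> ?s = times C S v w" .
  have "MA M ?s' \<cdot> Eta M (Prd S (Cod C w) (Cod C v)) = Eta M (Prd S (Cod C v) (Cod C w)) \<cdot> ?s'"
    using v w Eta_Comp[of ?s' "Prd S (Cod C v) (Cod C w)"] by simp
  then have "(MA M ?s' \<cdot> Eta M (Prd S (Cod C w) (Cod C v))) \<cdot> times C S w v \<cdot> ?s =
      (Eta M (Prd S (Cod C v) (Cod C w)) \<cdot> ?s') \<cdot> times C S w v \<cdot> ?s"
    by simp
  then have "MA M ?s' \<cdot> Eta M (Prd S (Cod C w) (Cod C v)) \<cdot> times C S w v \<cdot> ?s =
      Eta M (Prd S (Cod C v) (Cod C w)) \<cdot> times C S v w"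
    using v w s by simp
  then show ?thesis
    using v w by (simp add: right_eq_left left_pure kleisli_J_Arr) (simp add: kleisli_J_def)
qed

text \<open>Two morphisms with the left property agree after the second projection. After the first,
  both are related to the same pure composite, hence consistent, and joint cancellation
  applies.\<close>

lemma left_unique:
  assumes "jointly_monic" "strength_consistent" "v \<in> Arr C" "f \<in> Arr K"
    "h \<in> prod_hom K SK (J v) f" "left_property K SK R (J v) f h"
  shows "h = lt (J v) f"
proof (rule jointly_monicD[OF assms(1), of "Cod C v" "kcod f"])
  have P: "J v \<cdot>\<^bsub>K\<^esub> Pr1 SK (Dom C v) (kdom f) \<in> P"
    using assms by (simp add: kleisli_J_Comp kleisli_Arr kleisli_pure_def)
  show "consistent P R (J (Pr1 S (Cod C v) (kcod f)) \<cdot>\<^bsub>K\<^esub> h)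
      (J (Pr1 S (Cod C v) (kcod f)) \<cdot>\<^bsub>K\<^esub> lt (J v) f)"
    using assms(6) left_property_left[OF assms(2-4)] P
    by (auto simp: consistent_def left_property_def)
qed (use assms left_property_left[OF assms(2-4)] left_prod_hom[OF assms(3,4)] in
    \<open>auto simp: left_property_def prod_hom_def kleisli_Arr\<close>)

text \<open>The projections exchange roles, hence the swapped form of joint cancellation.\<close>

lemma right_unique:
  assumes "jointly_monic" "strength_consistent" "v \<in> Arr C" "f \<in> Arr K"
    "h \<in> prod_hom K SK f (J v)" "right_property K SK R f (J v) h"
  shows "h = rt f (J v)"
proof (rule jointly_monic_swapD[OF assms(1), of "kcod f" "Cod C v"])
  have P: "J v \<cdot>\<^bsub>K\<^esub> Pr2 SK (kdom f) (Dom C v) \<in> P"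
    using assms by (simp add: kleisli_J_Comp kleisli_Arr kleisli_pure_def)
  show "consistent P R (J (Pr2 S (kcod f) (Cod C v)) \<cdot>\<^bsub>K\<^esub> h)
      (J (Pr2 S (kcod f) (Cod C v)) \<cdot>\<^bsub>K\<^esub> rt f (J v))"
    using assms(6) right_property_right[OF assms(2-4)] P
    by (auto simp: consistent_def right_property_def)
qed (use assms right_property_right[OF assms(2-4)] right_prod_hom[OF assms(3,4)] in
    \<open>auto simp: right_property_def prod_hom_def kleisli_Arr\<close>)

text \<open>The complementarity demanded by \<open>weak_iff\<close> is supplied by joint
  cancellation.\<close>

lemma cartesian_effect:
  assumes strength_consistent jointly_monic
  shows "cartesian_effect_category K P SK R lt rt"
proof -
  have "weak_cartesian_effect_category K P SK R lt rt"
    using assms jointly_monic_complementarity weak_iff by blast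
  moreover have "lt v w = times (subcat K P) SK v w \<and> rt v w = times (subcat K P) SK v w"
    if vw: "v \<in> P" "w \<in> P" for v w
  proof -
    obtain v0 w0 where "v = J v0" "w = J w0" "v0 \<in> Arr C" "w0 \<in> Arr C"
      using vw by (auto simp: kleisli_pure_def)
    then show ?thesis by (simp add: times_pure left_pure right_pure)
  qed
  moreover have "h = lt v f" if "v \<in> P" "f \<in> Arr K" "h \<in> prod_hom K SK v f"
    "left_property K SK R v f h" for v f h
    using that left_unique[OF assms(2,1)] by (auto simp: kleisli_pure_def)
  moreover have "h = rt f v" if "v \<in> P" "f \<in> Arr K" "h \<in> prod_hom K SK f v"
    "right_property K SK R f v h" for v f h
    using that right_unique[OF assms(2,1)] by (auto simp: kleisli_pure_def)
  ultimately show ?thesis unfolding cartesian_effect_category_def by blast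
qed

end

theorem theorem19:
  fixes C0 :: "('o, 'm) category" and S :: "('o, 'm) products" and M :: "('o, 'm) monad"
    and t :: "'o \<Rightarrow> 'o \<Rightarrow> 'm"
    and K :: "('o, ('o, 'm) karr) category" and C :: "('o, 'm) karr set"
    and SK :: "('o, ('o, 'm) karr) products"
    and R :: "('o, 'm) karr \<Rightarrow> ('o, 'm) karr \<Rightarrow> bool"
  assumes strong: "strong_monad C0 S M t"
    and mono: "\<And>X. X \<in> Obj C0 \<Longrightarrow> mono_arrow C0 (Eta M X)"
    and K: "K = kleisli C0 M"
    and C: "C = kleisli_pure C0 M"
    and SK: "SK = kleisli_products C0 S M"
    and consistency: "consistency_relation K C R"
  shows
    "(weak_cartesian_effect_category K C SK R (kleisli_left C0 S M t) (kleisli_right C0 S M t) \<longleftrightarrow>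
      complementarity K C (One SK) R \<and>
      (\<forall>Y1 \<in> Obj C0. \<forall>Y2 \<in> Obj C0.
        R (Pr1 SK Y1 Y2 \<cdot>\<^bsub>K\<^esub> KArr (Prd S Y1 (MO M Y2)) (Prd S Y1 Y2) (t Y1 Y2))
          (Pr1 SK Y1 (MO M Y2))))
    \<and>
    (\<forall>Y1 \<in> Obj C0. \<forall>Y2 \<in> Obj C0.
      R (Pr1 SK Y1 Y2 \<cdot>\<^bsub>K\<^esub> KArr (Prd S Y1 (MO M Y2)) (Prd S Y1 Y2) (t Y1 Y2))
        (Pr1 SK Y1 (MO M Y2)) \<longleftrightarrow>
      rel0 C0 M R (Prd S Y1 (MO M Y2)) Y1
        (MA M (Pr1 S Y1 Y2) \<cdot>\<^bsub>C0\<^esub> t Y1 Y2) (Eta M Y1 \<cdot>\<^bsub>C0\<^esub> Pr1 S Y1 (MO M Y2)))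
    \<and>
    ((\<forall>Y1 \<in> Obj C0. \<forall>Y2 \<in> Obj C0.
        R (Pr1 SK Y1 Y2 \<cdot>\<^bsub>K\<^esub> KArr (Prd S Y1 (MO M Y2)) (Prd S Y1 Y2) (t Y1 Y2))
          (Pr1 SK Y1 (MO M Y2)))
      \<longrightarrow>
      (\<forall>X \<in> Obj C0. \<forall>Y1 \<in> Obj C0. \<forall>Y2 \<in> Obj C0.
        \<forall>\<phi> \<in> hom C0 X (MO M (Prd S Y1 Y2)). \<forall>\<phi>' \<in> hom C0 X (MO M (Prd S Y1 Y2)).
          consistent0 C0 M R X Y1
            (MA M (Pr1 S Y1 Y2) \<cdot>\<^bsub>C0\<^esub> \<phi>) (MA M (Pr1 S Y1 Y2) \<cdot>\<^bsub>C0\<^esub> \<phi>') \<and>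
          MA M (Pr2 S Y1 Y2) \<cdot>\<^bsub>C0\<^esub> \<phi> = MA M (Pr2 S Y1 Y2) \<cdot>\<^bsub>C0\<^esub> \<phi>' \<longrightarrow>
          \<phi> = \<phi>')
      \<longrightarrow>
      cartesian_effect_category K C SK R (kleisli_left C0 S M t) (kleisli_right C0 S M t))"
proof -
  interpret kleisli_consistency C0 S M t R
    using strong mono consistency
    unfolding K C by (intro kleisli_consistency.intro kleisli_consistency_axioms.intro)
  show ?thesis
    unfolding K C SK
    using weak_iff strength_iff_rel0 cartesian_effect by blast
qed

end
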